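(* Let $\mu$ be a Borel probability measure on $\mathbb{P}_m$ satisfying $$\int_{\mathbb{P}_m}\bigl(\|X\|+\|X^{-1}\|\bigr)^r\,d\mu(X)<\infty$$ for some $r>0$. Then $$\lim_{t\to0}G(\mu^t)^{\frac1t}=\exp\int_{\mathbb{P}_m}\log X\,d\mu(X),$$ where the limit is over real $t\ne0$ (of either sign).
   Context: $\mathbb{P}_m$ is the set of $m\times m$ (complex Hermitian) positive definite matrices, $\|\cdot\|$ is the operator norm, and $d(A,B)=\|\log A^{-1/2}BA^{-1/2}\|_2$ is the Riemannian trace metric on $\mathbb{P}_m$, where $\|X\|_2=(\operatorname{tr}X^2)^{1/2}$ for Hermitian $X$. $\mathcal{P}^1(\mathbb{P}_m)$ is the set of Borel probability measures $\mu$ on $\mathbb{P}_m$ with $\int d(X,Y)\,d\mu(X)<\infty$ for some (equivalently, all) $Y\in\mathbb{P}_m$. Cartan barycenter: for $\mu\in\mathcal{P}^1(\mathbb{P}_m)$, $G(\mu)$ is the unique minimizer over $Z\in\mathbb{P}_m$ of $\int_{\mathbb{P}_m}[d^2(Z,X)-d^2(Y,X)]\,d\mu(X)$, where $Y\in\mathbb{P}_m$ is fixed; the minimizer exists, is unique, and does not depend on $Y$. For $t\in\mathbb{R}\setminus\{0\}$, $\mu^t$ is the push-forward of $\mu$ under $X\mapsto X^t$. A measure satisfying the integrability condition in the claim belongs to $\mathcal{P}^1(\mathbb{P}_m)$, as do all its powers $\mu^t$, so $G(\mu^t)$ and the matrix-valued integral $\int\log X\,d\mu(X)$ are well defined. 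*)

theory Defs
  imports "HOL-Probability.Probability"
begin

text \<open>
  The index type \<open>'n\<close> plays the role of \<open>{1,\<dots>,m}\<close>, with \<open>m = CARD('n)\<close>. The library norm on
  \<^typ>\<open>complex^'n^'n\<close> is only used for its topology, its Borel sets and the Bochner integral;
  the operator norm is written \<open>onorm ((*v) X)\<close>, for the Euclidean norm of \<^typ>\<open>complex^'n\<close>.
\<close>

definition cadjoint :: "complex^'n^'n \<Rightarrow> complex^'n^'n" where
  "cadjoint A = (\<chi> i j. cnj (A $ j $ i))"

definition hermitian :: "complex^'n^'n \<Rightarrow> bool" where
  "hermitian A \<longleftrightarrow> cadjoint A = A"

definition unitary :: "complex^'n^'n \<Rightarrow> bool" where
  "unitary U \<longleftrightarrow> cadjoint U ** U = mat 1 \<and> U ** cadjoint U = mat 1"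

text \<open>For Hermitian \<open>A\<close> the form \<open>x\<^sup>* A x\<close> is real, so taking its real part loses nothing.\<close>

definition posdef :: "(complex^'n^'n) set" where
  "posdef = {A. hermitian A \<and>
     (\<forall>x. x \<noteq> 0 \<longrightarrow> 0 < Re (\<Sum>i\<in>UNIV. cnj (x $ i) * (A *v x) $ i))}"

definition real_diag :: "('n \<Rightarrow> real) \<Rightarrow> complex^'n^'n" where
  "real_diag d = (\<chi> i j. if i = j then complex_of_real (d i) else 0)"

text \<open>Functional calculus of Hermitian matrices:
  \<open>f (U diag(d) U\<^sup>*) = U diag(f \<circ> d) U\<^sup>*\<close>, independently of the chosen diagonalization.\<close>

definition herm_fun :: "(real \<Rightarrow> real) \<Rightarrow> complex^'n^'n \<Rightarrow> complex^'n^'n" where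
  "herm_fun f A = (THE B. \<exists>U d. unitary U \<and> A = U ** real_diag d ** cadjoint U \<and>
                                B = U ** real_diag (f \<circ> d) ** cadjoint U)"

lemma real_diag_intertwine:
  fixes W :: "complex^'n^'n"
  assumes "W ** real_diag d = real_diag e ** W"
  shows "W ** real_diag (f \<circ> d) = real_diag (f \<circ> e) ** W"
proof -
  have l: "(W ** real_diag d) $ i $ j = W $ i $ j * complex_of_real (d j)"
    and r: "(real_diag d ** W) $ i $ j = complex_of_real (d i) * W $ i $ j" for d :: "'n \<Rightarrow> real" and i j
    by (simp_all add: matrix_matrix_mult_def real_diag_def if_distrib if_distribR sum.delta sum.delta' cong: if_cong)
  have "W $ i $ j * complex_of_real (d j) = complex_of_real (e i) * W $ i $ j" for i j
    using assms l r by metis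
  then have "W $ i $ j = 0 \<or> d j = e i" for i j
    by (metis mult.commute mult_cancel_left of_real_eq_iff)
  then have "W $ i $ j * complex_of_real (f (d j)) = complex_of_real (f (e i)) * W $ i $ j" for i j
    by (metis mult.commute mult_zero_left)
  then show ?thesis
    by (simp add: vec_eq_iff l r)
qed

lemma herm_fun_diagonalized:
  assumes "unitary U"
  shows "herm_fun f (U ** real_diag d ** cadjoint U) = U ** real_diag (f \<circ> d) ** cadjoint U"
  unfolding herm_fun_def
proof (rule the_equality)
  show "\<exists>V e. unitary V \<and> U ** real_diag d ** cadjoint U = V ** real_diag e ** cadjoint V \<and>
          U ** real_diag (f \<circ> d) ** cadjoint U = V ** real_diag (f \<circ> e) ** cadjoint V"
    using assms by blast
next
  fix B
  assume "\<exists>V e. unitary V \<and> U ** real_diag d ** cadjoint U = V ** real_diag e ** cadjoint V \<and>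
            B = V ** real_diag (f \<circ> e) ** cadjoint V"
  then obtain V e where V: "unitary V"
    and eq: "U ** real_diag d ** cadjoint U = V ** real_diag e ** cadjoint V"
    and B: "B = V ** real_diag (f \<circ> e) ** cadjoint V" by blast
  have u: "cadjoint U ** U = mat 1" "U ** cadjoint U = mat 1"
    "cadjoint V ** V = mat 1" "V ** cadjoint V = mat 1"
    using assms V by (auto simp: unitary_def)
  have "(cadjoint V ** U) ** real_diag d
      = cadjoint V ** (U ** real_diag d ** cadjoint U) ** U"
    by (metis matrix_mul_assoc matrix_mul_rid u(1))
  also have "\<dots> = real_diag e ** (cadjoint V ** U)"
    unfolding eq by (metis matrix_mul_assoc matrix_mul_lid u(3))
  finally have "(cadjoint V ** U) ** real_diag (f \<circ> d) = real_diag (f \<circ> e) ** (cadjoint V ** U)"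
    by (rule real_diag_intertwine)
  then have "V ** ((cadjoint V ** U) ** real_diag (f \<circ> d)) ** cadjoint U
           = V ** (real_diag (f \<circ> e) ** (cadjoint V ** U)) ** cadjoint U"
    by simp
  then show "B = U ** real_diag (f \<circ> d) ** cadjoint U"
    unfolding B by (metis matrix_mul_assoc matrix_mul_lid matrix_mul_rid u(2) u(4))
qed

definition herm_exp :: "complex^'n^'n \<Rightarrow> complex^'n^'n" where
  "herm_exp = herm_fun exp"

definition herm_log :: "complex^'n^'n \<Rightarrow> complex^'n^'n" where
  "herm_log = herm_fun ln"

definition herm_powr :: "complex^'n^'n \<Rightarrow> real \<Rightarrow> complex^'n^'n" where
  "herm_powr A t = herm_fun (\<lambda>x. x powr t) A"

definition trace_norm2 :: "complex^'n^'n \<Rightarrow> real" where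
  "trace_norm2 X = sqrt (Re (trace (X ** X)))"

definition trace_dist :: "complex^'n^'n \<Rightarrow> complex^'n^'n \<Rightarrow> real" where
  "trace_dist A B = trace_norm2 (herm_log (herm_powr A (- 1/2) ** B ** herm_powr A (- 1/2)))"

text \<open>A Borel probability measure on the set of positive definite matrices is a probability
  measure whose \<open>\<sigma>\<close>-algebra is the following one (its space is then \<^const>\<open>posdef\<close>). The subspace
  topology used here coincides with the topology of \<^const>\<open>trace_dist\<close>.\<close>

definition borel_posdef :: "(complex^'n^'n) measure" where
  "borel_posdef = restrict_space borel posdef"

definition cartan_objective ::
    "(complex^'n^'n) measure \<Rightarrow> complex^'n^'n \<Rightarrow> complex^'n^'n \<Rightarrow> real" where
  "cartan_objective M Y Z = (\<integral>X. (trace_dist Z X)\<^sup>2 - (trace_dist Y X)\<^sup>2 \<partial>M)"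

text \<open>Changing the base point \<open>Y\<close> shifts the objective by a constant when \<open>M\<close> has finite first
  moment, so it does not matter that all base points occur here.\<close>

definition cartan_barycenter :: "(complex^'n^'n) measure \<Rightarrow> complex^'n^'n" where
  "cartan_barycenter M =
     (THE Z. \<forall>Y\<in>posdef. is_arg_min (cartan_objective M Y) (\<lambda>W. W \<in> posdef) Z)"

definition measure_powr :: "(complex^'n^'n) measure \<Rightarrow> real \<Rightarrow> (complex^'n^'n) measure" where
  "measure_powr M t = distr M borel_posdef (\<lambda>X. herm_powr X t)"

end

theory Submission
  imports Defs
begin

text \<open>
  Write \<open>X = exp K\<close>. On Hermitian matrices the norm \<open>\<parallel>_\<parallel>\<close> of \<^typ>\<open>complex^'n^'n\<close> is the trace norm,
  and the distances are compared with those of the flat space of logarithms through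
  \<open>Q(A,B) = tr A\<inverse>B + tr B\<inverse>A - 2m\<close>. In eigenbases of \<open>log A\<close> and \<open>log B\<close> this is a doubly
  stochastic average of \<open>h(b\<^sub>j - a\<^sub>i)\<close>, where \<open>h(x) = e\<^sup>x + e\<^sup>-\<^sup>x - 2\<close>, and it is also the sum of
  \<open>h\<close> over the eigenvalues of \<open>log (A\<^sup>-\<^sup>1\<^sup>/\<^sup>2 B A\<^sup>-\<^sup>1\<^sup>/\<^sup>2)\<close>. Since \<open>x\<^sup>2 \<le> h(x) \<le> x\<^sup>2 e\<^sup>|\<^sup>x\<^sup>|\<close>, both
  \<open>\<parallel>log A - log B\<parallel>\<^sup>2\<close> and \<open>d(A,B)\<^sup>2\<close> are at most \<open>Q(A,B)\<close>. Subdividing the geodesic from \<open>A\<close> to \<open>B\<close>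
  turns the first bound into the exponential metric increasing property
  \<open>\<parallel>log A - log B\<parallel> \<le> d(A,B)\<close>, which yields the semi-parallelogram law and with it existence and
  uniqueness of the barycenter.

  Now let \<open>L = \<integral> log X d\<mu>\<close> and \<open>G(\<mu>\<^sup>t) = exp (t W)\<close>. By the metric increasing property and
  minimality,
  \<open>\<parallel>W - L\<parallel>\<^sup>2 + \<integral> \<parallel>L - log X\<parallel>\<^sup>2 d\<mu> = \<integral> \<parallel>W - log X\<parallel>\<^sup>2 d\<mu> \<le> t\<^sup>-\<^sup>2 \<integral> d(exp (t L), X\<^sup>t)\<^sup>2 d\<mu>\<close>, and the right-hand
  side tends to \<open>\<integral> \<parallel>L - log X\<parallel>\<^sup>2 d\<mu>\<close> by dominated convergence, so \<open>W \<longlongrightarrow> L\<close>.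
\<close>

section \<open>Spectral theorem and functional calculus\<close>

lemma cadjoint_component [simp]: "cadjoint A $ i $ j = cnj (A $ j $ i)"
  by (simp add: cadjoint_def)

lemma cadjoint_mult: "cadjoint (A ** B) = cadjoint B ** cadjoint A"
  by (simp add: vec_eq_iff matrix_matrix_mult_def mult.commute)

lemma cadjoint_cadjoint [simp]: "cadjoint (cadjoint A) = A"
  by (simp add: vec_eq_iff)

lemma cadjoint_mat_1 [simp]: "cadjoint (mat 1) = mat 1"
  by (simp add: vec_eq_iff mat_def)

lemma cadjoint_real_diag [simp]: "cadjoint (real_diag d) = real_diag d"
  by (simp add: vec_eq_iff real_diag_def)

lemma bounded_linear_cadjoint: "bounded_linear cadjoint"
  by (intro linear_conv_bounded_linear[THEN iffD1] linearI)
     (simp_all add: vec_eq_iff)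

lemma inner_eq_trace: "A \<bullet> B = Re (trace (cadjoint A ** B))" for A B :: "complex^'n^'n"
proof -
  have "A \<bullet> B = (\<Sum>i\<in>UNIV. \<Sum>k\<in>UNIV. Re (cnj (A $ i $ k) * B $ i $ k))"
    by (simp add: inner_vec_def inner_complex_def)
  also have "\<dots> = (\<Sum>k\<in>UNIV. \<Sum>i\<in>UNIV. Re (cnj (A $ i $ k) * B $ i $ k))"
    by (rule sum.swap)
  also have "\<dots> = Re (trace (cadjoint A ** B))"
    by (simp add: trace_def matrix_matrix_mult_def)
  finally show ?thesis .
qed

text \<open>The inner product of the type \<open>complex^'n\<close> is only the real part of this
  form. Orthonormality of the columns of a unitary matrix needs the complex value.\<close>

definition cinner :: "complex^'n \<Rightarrow> complex^'n \<Rightarrow> complex" where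
  "cinner x y = (\<Sum>i\<in>UNIV. cnj (x $ i) * y $ i)"

lemma Re_cinner: "Re (cinner x y) = x \<bullet> y"
  by (simp add: cinner_def inner_vec_def inner_complex_def)

lemma cinner_self: "cinner x x = complex_of_real ((norm x)\<^sup>2)"
proof -
  have "cinner x x = (\<Sum>i\<in>UNIV. complex_of_real ((cmod (x $ i))\<^sup>2))"
    by (simp add: cinner_def complex_norm_square mult.commute del: of_real_power)
  also have "\<dots> = complex_of_real ((norm x)\<^sup>2)"
    by (simp add: norm_vec_def L2_set_def sum_nonneg del: of_real_power of_real_sum
        flip: of_real_sum)
  finally show ?thesis .
qed

lemma cinner_commute: "cinner x y = cnj (cinner y x)"
  by (simp add: cinner_def mult.commute)

lemma cinner_cadjoint: "cinner (cadjoint A *v x) y = cinner x (A *v y)"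
proof -
  have "cinner (cadjoint A *v x) y = (\<Sum>i\<in>UNIV. \<Sum>j\<in>UNIV. cnj (x $ j) * A $ j $ i * y $ i)"
    by (simp add: cinner_def matrix_vector_mult_def sum_distrib_right sum_distrib_left mult.commute
        mult.left_commute)
  also have "\<dots> = (\<Sum>j\<in>UNIV. \<Sum>i\<in>UNIV. cnj (x $ j) * A $ j $ i * y $ i)"
    by (rule sum.swap)
  also have "\<dots> = cinner x (A *v y)"
    by (simp add: cinner_def matrix_vector_mult_def sum_distrib_left mult.assoc)
  finally show ?thesis .
qed

lemma inner_cadjoint: "(cadjoint A *v x) \<bullet> y = x \<bullet> (A *v y)"
  by (metis cinner_cadjoint Re_cinner)

lemma inner_hermitian: "hermitian A \<Longrightarrow> (A *v x) \<bullet> y = x \<bullet> (A *v y)"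
  by (metis hermitian_def inner_cadjoint)

lemma posdef_iff: "A \<in> posdef \<longleftrightarrow> hermitian A \<and> (\<forall>x. x \<noteq> 0 \<longrightarrow> 0 < x \<bullet> (A *v x))"
  by (simp add: posdef_def flip: cinner_def Re_cinner)

section \<open>Diagonalization of Hermitian matrices\<close>

lemma scaleR_matrix_vector_mult: "c *\<^sub>R (A *v x) = A *v (c *\<^sub>R x)" for A :: "complex^'n^'n"
  by (simp add: vec_eq_iff matrix_vector_mult_def scaleR_sum_right)

text \<open>The induction step of the spectral theorem. The complement \<open>E\<close> of the
  eigenvectors found so far is invariant under \<open>A\<close>, and a maximizer of the Rayleigh
  quotient on its unit sphere is an eigenvector. The free index \<open>k\<close> guarantees that
  \<open>E\<close> is not zero.\<close>

lemma hermitian_eigenvector_in_complement: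
  fixes A :: "complex^'n^'n" and k :: 'n and v :: "'n \<Rightarrow> complex^'n"
  assumes A: "hermitian A" and k: "k \<notin> S"
    and eig: "\<And>i. i \<in> S \<Longrightarrow> A *v v i = d i *\<^sub>R v i"
  obtains u c where "norm u = 1" "\<And>i. i \<in> S \<Longrightarrow> cinner (v i) u = 0" "A *v u = c *\<^sub>R u"
proof -
  define E where "E = {x. \<forall>i\<in>S. cinner (v i) x = 0}"
  have add: "x + y \<in> E" if "x \<in> E" "y \<in> E" for x y
    using that by (simp add: E_def cinner_def distrib_left sum.distrib)
  have scale: "c *\<^sub>R x \<in> E" if "x \<in> E" for x and c :: real
  proof -
    have "cinner y (c *\<^sub>R x) = c *\<^sub>R cinner y x" for y
      by (simp add: cinner_def scaleR_sum_right)
    then show ?thesis using that by (simp add: E_def)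
  qed
  have inv: "A *v x \<in> E" if "x \<in> E" for x
  proof -
    have "cinner (v i) (A *v x) = 0" if "i \<in> S" for i
    proof -
      have "cinner (v i) (A *v x) = cinner (d i *\<^sub>R v i) x"
        using A eig[OF that] by (metis cinner_cadjoint hermitian_def)
      also have "\<dots> = d i *\<^sub>R cinner (v i) x"
        by (simp add: cinner_def scaleR_sum_right)
      finally show ?thesis using \<open>x \<in> E\<close> that by (simp add: E_def)
    qed
    then show ?thesis by (simp add: E_def)
  qed
  \<comment> \<open>The rows of \<open>M\<close> with index in \<open>S\<close> are the conjugated
    eigenvectors, all others vanish. Row \<open>k\<close> makes \<open>M\<close> singular, and any
    kernel vector lies in \<open>E\<close>.\<close>
  define M :: "complex^'n^'n" where "M = (\<chi> i j. if i \<in> S then cnj (v i $ j) else 0)"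
  have "row k M = 0"
    using k by (simp add: row_def M_def vec_eq_iff)
  then have "det M = 0" by (rule det_zero_row(2))
  then obtain x where x: "x \<noteq> 0" "M *v x = 0"
    using invertible_det_nz[of M] matrix_left_invertible_ker[of M]
    by (metis invertible_left_inverse)
  have "x \<in> E"
  proof -
    have "cinner (v i) x = (M *v x) $ i" if "i \<in> S" for i
      using that by (simp add: cinner_def M_def matrix_vector_mult_def)
    then show ?thesis using x by (simp add: E_def)
  qed
  define T where "T = E \<inter> sphere 0 1"
  have "(1 / norm x) *\<^sub>R x \<in> T"
    using x scale[OF \<open>x \<in> E\<close>] by (simp add: T_def)
  then have "T \<noteq> {}" by auto
  have "closed E"
  proof -
    have "E = (\<Inter>i\<in>S. {x. cinner (v i) x = 0})"
      by (auto simp: E_def)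
    moreover have "closed {x. cinner (v i) x = 0}" for i
      unfolding cinner_def by (intro closed_Collect_eq continuous_intros)
    ultimately show ?thesis by auto
  qed
  then have "compact T"
    unfolding T_def by (simp add: closed_Int_compact)
  moreover have "continuous_on T (\<lambda>x. x \<bullet> (A *v x))"
    unfolding matrix_vector_mult_def by (intro continuous_intros)
  ultimately obtain u where u: "u \<in> T" and max: "\<And>y. y \<in> T \<Longrightarrow> y \<bullet> (A *v y) \<le> u \<bullet> (A *v u)"
    using continuous_attains_sup[OF _ \<open>T \<noteq> {}\<close>] by metis
  define c where "c = u \<bullet> (A *v u)"
  have uE: "u \<in> E" and u1: "norm u = 1" using u by (auto simp: T_def)
  \<comment> \<open>The maximality of \<open>u\<close> without denominators: \<open>g\<close> is at
    most 0 on \<open>E\<close> and vanishes at \<open>u\<close>.\<close>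
  define g where "g x = x \<bullet> (A *v x) - c * (x \<bullet> x)" for x
  have g_le: "g y \<le> 0" if "y \<in> E" for y
  proof (cases "y = 0")
    case False
    have "(1 / norm y) *\<^sub>R y \<in> T"
      using False scale[OF that] by (simp add: T_def)
    from max[OF this] have "(y \<bullet> (A *v y)) / (norm y)\<^sup>2 \<le> c"
      by (simp add: c_def power2_eq_square flip: scaleR_matrix_vector_mult)
    then show ?thesis
      using False by (simp add: g_def divide_simps power2_norm_eq_inner split: if_splits)
  qed (simp add: g_def)
  \<comment> \<open>The residual of the eigenvector equation lies in \<open>E\<close>, so moving
    \<open>u\<close> along it is an admissible variation. Its first-order effect on \<open>g\<close>
    is \<open>2 * s * (w \<bullet> w)\<close>, which forces \<open>w = 0\<close>.\<close>
  define w where "w = A *v u - c *\<^sub>R u"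
  have wE: "w \<in> E"
    using add[OF inv[OF uE] scale[OF uE, of "- c"]] by (simp add: w_def)
  have expand: "g (u + s *\<^sub>R w) = 2 * s * (w \<bullet> w) + s\<^sup>2 * g w" for s
  proof -
    have 1: "u \<bullet> (A *v w) = w \<bullet> (A *v u)"
      using inner_hermitian[OF A, of u w] by (simp add: inner_commute)
    have 2: "w \<bullet> w = w \<bullet> (A *v u) - c * (w \<bullet> u)"
      by (subst (2) w_def) (simp add: inner_diff_right)
    have 3: "u \<bullet> (A *v u) = c" "u \<bullet> u = 1"
      using u1 by (auto simp: c_def norm_eq_1)
    show ?thesis
      unfolding g_def
      by (simp add: matrix_vector_right_distrib inner_add_left inner_add_right 1 2 3
          algebra_simps power2_eq_square inner_commute flip: scaleR_matrix_vector_mult)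
  qed
  have "w \<bullet> w = 0"
  proof (rule ccontr)
    assume "w \<bullet> w \<noteq> 0"
    then have pos: "w \<bullet> w > 0" by (simp add: order_less_le)
    \<comment> \<open>Small enough for the second-order term \<open>s * g w\<close> to be bounded by
      \<open>w \<bullet> w\<close>, hence unable to cancel
      \<open>2 * (w \<bullet> w)\<close>.\<close>
    define s where "s = (w \<bullet> w) / (1 + \<bar>g w\<bar>)"
    have s: "s > 0" using pos by (simp add: s_def add_pos_nonneg)
    have "2 * s * (w \<bullet> w) + s\<^sup>2 * g w \<le> 0"
      using g_le[OF add[OF uE scale[OF wE, of s]]] by (simp add: expand)
    then have "s * (2 * (w \<bullet> w) + s * g w) \<le> 0"
      by (simp add: algebra_simps power2_eq_square)
    then have "2 * (w \<bullet> w) + s * g w \<le> 0"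
      using s by (simp add: mult_le_0_iff)
    moreover have "\<bar>s * g w\<bar> \<le> w \<bullet> w"
    proof -
      have "\<bar>s * g w\<bar> \<le> s * (1 + \<bar>g w\<bar>)"
        using s by (simp add: abs_mult)
      also have "\<dots> = w \<bullet> w"
        unfolding s_def using pos by (simp add: add_nonneg_eq_0_iff)
      finally show ?thesis .
    qed
    ultimately show False using pos by linarith
  qed
  then have "A *v u = c *\<^sub>R u" by (simp add: w_def)
  with u1 uE show ?thesis
    by (intro that[of u c]) (auto simp: E_def)
qed

text \<open>Induction on the set \<open>S\<close> of indices that already carry orthonormal
  eigenvectors. Indexing them by the matrix index type makes them directly the columns of
  \<open>U\<close>.\<close>

theorem hermitian_diagonalizable:
  fixes A :: "complex^'n^'n"
  assumes A: "hermitian A"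
  obtains U d where "unitary U" "A = U ** real_diag d ** cadjoint U"
proof -
  have "\<exists>v d. (\<forall>i\<in>S. \<forall>j\<in>S. cinner (v i) (v j) = (if i = j then 1 else 0)) \<and>
          (\<forall>i\<in>S. A *v v i = d i *\<^sub>R v i)" if "finite S" for S :: "'n set"
    using that
  proof induction
    case (insert k S)
    then obtain v d where v: "\<And>i j. i \<in> S \<Longrightarrow> j \<in> S \<Longrightarrow> cinner (v i) (v j) = (if i = j then 1 else 0)"
      and eig: "\<And>i. i \<in> S \<Longrightarrow> A *v v i = d i *\<^sub>R v i" by blast
    obtain u c where u: "norm u = 1" "\<And>i. i \<in> S \<Longrightarrow> cinner (v i) u = 0" "A *v u = c *\<^sub>R u"
      by (rule hermitian_eigenvector_in_complement[OF A insert.hyps(2), of v d]) (use eig in auto)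
    have "cinner u (v i) = 0" if "i \<in> S" for i
      using u(2)[OF that] cinner_commute[of u "v i"] by simp
    moreover have "cinner u u = 1"
      using u(1) by (simp add: cinner_self)
    ultimately show ?case
      using u v eig insert.hyps(2)
      by (intro exI[of _ "v(k := u)"] exI[of _ "d(k := c)"]) auto
  qed simp
  from this[of UNIV] obtain v :: "'n \<Rightarrow> complex^'n" and d
    where v: "\<And>i j. cinner (v i) (v j) = (if i = j then 1 else 0)"
      and eig: "\<And>i. A *v v i = d i *\<^sub>R v i" by force
  define U :: "complex^'n^'n" where "U = (\<chi> i j. v j $ i)"
  have 1: "cadjoint U ** U = mat 1"
    using v by (simp add: vec_eq_iff matrix_matrix_mult_def U_def mat_def cinner_def)
  then have 2: "U ** cadjoint U = mat 1"
    by (simp add: matrix_left_right_inverse)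
  have "A ** U = U ** real_diag d"
  proof -
    have "(A ** U) $ i $ j = (U ** real_diag d) $ i $ j" for i j
    proof -
      have "(A ** U) $ i $ j = (A *v v j) $ i"
        by (simp add: matrix_matrix_mult_def matrix_vector_mult_def U_def)
      also have "\<dots> = v j $ i * complex_of_real (d j)"
        by (simp add: eig scaleR_conv_of_real[where 'a = complex])
      also have "\<dots> = (U ** real_diag d) $ i $ j"
        by (simp add: matrix_matrix_mult_def U_def real_diag_def if_distrib if_distribR
            sum.delta sum.delta' cong: if_cong)
      finally show ?thesis .
    qed
    then show ?thesis by (simp add: vec_eq_iff)
  qed
  then have "A = U ** real_diag d ** cadjoint U"
    by (metis 2 matrix_mul_assoc matrix_mul_rid)
  with 1 2 show ?thesis
    using that by (simp add: unitary_def)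
qed

section \<open>Unitary and diagonal matrices\<close>

lemma unitary_cadjoint: "unitary U \<Longrightarrow> unitary (cadjoint U)"
  by (simp add: unitary_def)

lemma unitary_mult: "unitary U \<Longrightarrow> unitary V \<Longrightarrow> unitary (U ** V)"
  unfolding unitary_def cadjoint_mult
  by (metis matrix_mul_assoc matrix_mul_lid)

lemma unitary_cancel:
  assumes "unitary U"
  shows "cadjoint U ** U = mat 1" "U ** cadjoint U = mat 1"
    "cadjoint U ** (U ** X) = X" "U ** (cadjoint U ** X) = X"
  using assms by (simp_all add: unitary_def matrix_mul_assoc)

lemma norm_unitary_mult:
  fixes X :: "complex^'n^'n"
  assumes "unitary U"
  shows "norm (U ** X) = norm X" "norm (X ** U) = norm X"
proof -
  have "(U ** X) \<bullet> (U ** X) = X \<bullet> X"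
    unfolding inner_eq_trace cadjoint_mult
    by (simp add: unitary_cancel[OF assms] flip: matrix_mul_assoc)
  then show "norm (U ** X) = norm X" by (simp add: norm_eq_sqrt_inner)
  have "(X ** U) \<bullet> (X ** U) = Re (trace (cadjoint U ** (cadjoint X ** X ** U)))"
    unfolding inner_eq_trace cadjoint_mult by (simp flip: matrix_mul_assoc)
  also have "\<dots> = X \<bullet> X"
    by (subst trace_mul_sym) (simp add: unitary_cancel[OF assms] inner_eq_trace flip: matrix_mul_assoc)
  finally show "norm (X ** U) = norm X" by (simp add: norm_eq_sqrt_inner)
qed

lemma mult_real_diag_component:
  "(X ** real_diag d) $ i $ j = X $ i $ j * complex_of_real (d j)"
  "(real_diag d ** X) $ i $ j = complex_of_real (d i) * X $ i $ j"
  by (simp_all add: matrix_matrix_mult_def real_diag_def if_distrib if_distribR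
      sum.delta sum.delta' cong: if_cong)

lemma real_diag_mult: "real_diag d ** real_diag e = real_diag (\<lambda>i. d i * e i)"
  by (simp add: vec_eq_iff mult_real_diag_component) (simp add: real_diag_def)

lemma real_diag_1: "real_diag (\<lambda>i. 1) = mat 1"
  by (simp add: vec_eq_iff real_diag_def mat_def)

lemma trace_real_diag: "trace (real_diag d) = complex_of_real (\<Sum>i\<in>UNIV. d i)"
  by (simp add: trace_def real_diag_def)

lemma scaleR_real_diag: "c *\<^sub>R real_diag d = real_diag (\<lambda>i. c * d i)"
  by (simp add: vec_eq_iff real_diag_def scaleR_conv_of_real[where 'a = complex])

lemma hermitian_diag: "hermitian (U ** real_diag d ** cadjoint U)"
  by (simp add: hermitian_def cadjoint_mult matrix_mul_assoc)

lemma diag_mult: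
  assumes "unitary U"
  shows "(U ** real_diag d ** cadjoint U) ** (U ** real_diag e ** cadjoint U)
       = U ** real_diag (\<lambda>i. d i * e i) ** cadjoint U"
  unfolding real_diag_mult[symmetric]
  by (simp add: unitary_cancel[OF assms] flip: matrix_mul_assoc)

lemma trace_diag:
  assumes "unitary U"
  shows "trace (U ** real_diag d ** cadjoint U) = complex_of_real (\<Sum>i\<in>UNIV. d i)"
  by (subst trace_mul_sym)
     (simp add: unitary_cancel[OF assms] trace_real_diag matrix_mul_assoc)

lemma scaleR_matrix_mult:
  "c *\<^sub>R (A ** B) = (c *\<^sub>R A) ** B" "c *\<^sub>R (A ** B) = A ** (c *\<^sub>R B)"
  for A :: "complex^'n^'n"
  by (simp_all add: vec_eq_iff matrix_matrix_mult_def scaleR_sum_right)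

lemma scaleR_diag:
  "c *\<^sub>R (U ** real_diag d ** cadjoint U) = U ** real_diag (\<lambda>i. c * d i) ** cadjoint U"
  unfolding scaleR_real_diag[symmetric] by (simp flip: scaleR_matrix_mult)

section \<open>Rules of the functional calculus\<close>

lemma hermitian_herm_fun: "hermitian A \<Longrightarrow> hermitian (herm_fun f A)"
  by (metis herm_fun_diagonalized hermitian_diag hermitian_diagonalizable)

lemma herm_fun_mult:
  assumes "hermitian A"
  shows "herm_fun f A ** herm_fun g A = herm_fun (\<lambda>x. f x * g x) A"
proof -
  obtain U d where U: "unitary U" and A: "A = U ** real_diag d ** cadjoint U"
    using hermitian_diagonalizable[OF assms] .
  show ?thesis
    unfolding A herm_fun_diagonalized[OF U] diag_mult[OF U] by (simp add: comp_def)
qed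

lemma herm_fun_comp:
  assumes "hermitian A"
  shows "herm_fun f (herm_fun g A) = herm_fun (\<lambda>x. f (g x)) A"
proof -
  obtain U d where U: "unitary U" and A: "A = U ** real_diag d ** cadjoint U"
    using hermitian_diagonalizable[OF assms] .
  show ?thesis
    unfolding A herm_fun_diagonalized[OF U] by (simp add: comp_def)
qed

lemma herm_fun_scaleR:
  assumes "hermitian A"
  shows "herm_fun (\<lambda>x. c * x) A = c *\<^sub>R A"
proof -
  obtain U d where U: "unitary U" and A: "A = U ** real_diag d ** cadjoint U"
    using hermitian_diagonalizable[OF assms] .
  show ?thesis
    unfolding A herm_fun_diagonalized[OF U] scaleR_diag by (simp add: comp_def)
qed

lemma herm_fun_id: "hermitian A \<Longrightarrow> herm_fun (\<lambda>x. x) A = A"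
  using herm_fun_scaleR[of A 1] by simp

lemma herm_fun_1:
  assumes "hermitian A"
  shows "herm_fun (\<lambda>x. 1) A = mat 1"
proof -
  obtain U d where U: "unitary U" and A: "A = U ** real_diag d ** cadjoint U"
    using hermitian_diagonalizable[OF assms] .
  show ?thesis
    unfolding A herm_fun_diagonalized[OF U]
    by (simp add: comp_def real_diag_1 unitary_cancel[OF U])
qed

lemma herm_fun_unitary_conj:
  assumes "hermitian A" and W: "unitary W"
  shows "herm_fun f (W ** A ** cadjoint W) = W ** herm_fun f A ** cadjoint W"
proof -
  obtain U d where U: "unitary U" and A: "A = U ** real_diag d ** cadjoint U"
    using hermitian_diagonalizable[OF assms(1)] .
  have "W ** A ** cadjoint W = (W ** U) ** real_diag d ** cadjoint (W ** U)"
    by (simp add: A cadjoint_mult flip: matrix_mul_assoc)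
  then have "herm_fun f (W ** A ** cadjoint W)
      = (W ** U) ** real_diag (f \<circ> d) ** cadjoint (W ** U)"
    using herm_fun_diagonalized[OF unitary_mult[OF W U]] by metis
  then show ?thesis
    unfolding A herm_fun_diagonalized[OF U] by (simp add: cadjoint_mult matrix_mul_assoc)
qed

section \<open>Positive definiteness, exponential, logarithm and powers\<close>

lemma diag_eigenvector:
  assumes "unitary U"
  shows "norm (U *v axis i 1) = 1"
    "(U ** real_diag d ** cadjoint U) *v (U *v axis i 1) = d i *\<^sub>R (U *v axis i 1)"
proof -
  have "(U *v axis i 1) \<bullet> (U *v axis i 1) = axis i (1::complex) \<bullet> axis i 1"
    by (simp add: unitary_cancel[OF assms] matrix_vector_mul_assoc flip: inner_cadjoint[of U])
  then show "norm (U *v axis i 1) = 1"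
    by (simp add: norm_eq_1 inner_axis_axis)
  have "real_diag d *v axis i 1 = d i *\<^sub>R axis i 1"
    by (simp add: vec_eq_iff matrix_vector_mult_def real_diag_def axis_def if_distrib[of "\<lambda>x. _ * x"]
      sum.delta scaleR_conv_of_real[where 'a = complex] cong: if_cong)
  then show "(U ** real_diag d ** cadjoint U) *v (U *v axis i 1) = d i *\<^sub>R (U *v axis i 1)"
    by (simp add: unitary_cancel[OF assms] matrix_vector_mul_assoc scaleR_matrix_vector_mult
        flip: matrix_mul_assoc)
       (simp flip: matrix_vector_mul_assoc add: scaleR_matrix_vector_mult)
qed

lemma posdef_diag_pos:
  assumes "unitary U" "U ** real_diag d ** cadjoint U \<in> posdef"
  shows "0 < d i"
proof -
  let ?x = "U *v axis i 1"
  have 1: "norm ?x = 1" and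
    2: "(U ** real_diag d ** cadjoint U) *v ?x = d i *\<^sub>R ?x"
    using diag_eigenvector[OF assms(1)] by auto
  have "?x \<noteq> 0" using 1 by force
  then have "0 < ?x \<bullet> ((U ** real_diag d ** cadjoint U) *v ?x)"
    using assms(2) by (simp add: posdef_iff)
  also have "\<dots> = d i" unfolding 2 using 1 by (simp add: norm_eq_1)
  finally show ?thesis .
qed

lemma posdef_hermitian: "A \<in> posdef \<Longrightarrow> hermitian A"
  by (simp add: posdef_iff)

text \<open>The spectrum is positive, so identities such as \<open>exp (ln x) = x\<close>, valid
  only for positive \<open>x\<close>, pass to matrices.\<close>

lemma herm_fun_cong_posdef:
  assumes "A \<in> posdef" "\<And>x. x > 0 \<Longrightarrow> f x = g x"
  shows "herm_fun f A = herm_fun g A"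
proof -
  obtain U d where U: "unitary U" and A: "A = U ** real_diag d ** cadjoint U"
    using hermitian_diagonalizable[OF posdef_hermitian[OF assms(1)]] .
  have "f \<circ> d = g \<circ> d"
    using posdef_diag_pos[OF U assms(1)[unfolded A]] assms(2) by auto
  then show ?thesis unfolding A herm_fun_diagonalized[OF U] by simp
qed

lemma hermitian_scaleR: "hermitian A \<Longrightarrow> hermitian (c *\<^sub>R A)"
  by (simp add: hermitian_def vec_eq_iff)

lemma herm_exp_0: "herm_exp 0 = mat 1"
proof -
  have "hermitian (0 :: complex^'n^'n)" by (simp add: hermitian_def vec_eq_iff)
  then have "herm_fun exp (0 *\<^sub>R (0 :: complex^'n^'n)) = mat 1"
    by (subst herm_fun_scaleR[symmetric]) (auto simp: herm_fun_comp herm_fun_1)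
  then show ?thesis by (simp add: herm_exp_def)
qed

lemma hermitian_herm_exp: "hermitian H \<Longrightarrow> hermitian (herm_exp H)"
  by (simp add: herm_exp_def hermitian_herm_fun)

lemma hermitian_herm_log: "A \<in> posdef \<Longrightarrow> hermitian (herm_log A)"
  by (simp add: herm_log_def hermitian_herm_fun posdef_iff)

lemma herm_exp_mult:
  assumes "hermitian H"
  shows "herm_exp (s *\<^sub>R H) ** herm_exp (t *\<^sub>R H) = herm_exp ((s + t) *\<^sub>R H)"
  unfolding herm_exp_def herm_fun_scaleR[OF assms, symmetric] herm_fun_comp[OF assms]
    herm_fun_mult[OF assms] mult_exp_exp distrib_right ..

lemma herm_exp_inverse:
  assumes "hermitian H"
  shows "herm_exp H ** herm_exp (- H) = mat 1" "herm_exp (- H) ** herm_exp H = mat 1"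
  using herm_exp_mult[OF assms, of 1 "-1"] herm_exp_mult[OF assms, of "-1" 1]
  by (simp_all add: herm_exp_0)

text \<open>The form of the new matrix at \<open>x\<close> is the form of \<open>A\<close> at
  \<open>cadjoint C *v x\<close>, and the right inverse \<open>C'\<close> keeps that vector
  nonzero.\<close>

lemma posdef_congruence:
  assumes A: "A \<in> posdef" and C: "C ** C' = mat 1"
  shows "C ** A ** cadjoint C \<in> posdef"
proof -
  have "hermitian (C ** A ** cadjoint C)"
    using A by (simp add: posdef_iff hermitian_def cadjoint_mult matrix_mul_assoc)
  moreover have "0 < x \<bullet> ((C ** A ** cadjoint C) *v x)" if "x \<noteq> 0" for x
  proof -
    have "cadjoint C' *v (cadjoint C *v x) = x"
      using arg_cong[OF C, of cadjoint] by (simp add: cadjoint_mult matrix_vector_mul_assoc)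
    then have "cadjoint C *v x \<noteq> 0"
      using that by force
    then have "0 < (cadjoint C *v x) \<bullet> (A *v (cadjoint C *v x))"
      using A by (simp add: posdef_iff)
    then show ?thesis
      by (simp add: inner_cadjoint matrix_vector_mul_assoc matrix_mul_assoc)
  qed
  ultimately show ?thesis by (simp add: posdef_iff)
qed

lemma posdef_mat_1: "mat 1 \<in> posdef"
  by (simp add: posdef_iff hermitian_def)

text \<open>The exponential is the congruence of the identity by the Hermitian invertible matrix
  \<open>herm_exp ((1/2) *\<^sub>R H)\<close>.\<close>

lemma posdef_herm_exp:
  assumes "hermitian H"
  shows "herm_exp H \<in> posdef"
proof -
  have h: "hermitian ((1/2) *\<^sub>R H)" by (simp add: assms hermitian_scaleR)
  have "herm_exp ((1/2) *\<^sub>R H) ** mat 1 ** cadjoint (herm_exp ((1/2) *\<^sub>R H)) \<in> posdef"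
    by (rule posdef_congruence[OF posdef_mat_1 herm_exp_inverse(1)[OF h]])
  also have "herm_exp ((1/2) *\<^sub>R H) ** mat 1 ** cadjoint (herm_exp ((1/2) *\<^sub>R H)) = herm_exp H"
    using hermitian_herm_exp[OF h] herm_exp_mult[OF assms, of "1/2" "1/2"]
    by (simp add: hermitian_def)
  finally show ?thesis .
qed

lemma herm_log_exp: "hermitian H \<Longrightarrow> herm_log (herm_exp H) = H"
  by (simp add: herm_log_def herm_exp_def herm_fun_comp herm_fun_id)

lemma herm_exp_log: "A \<in> posdef \<Longrightarrow> herm_exp (herm_log A) = A"
  using herm_fun_cong_posdef[of A "\<lambda>x. exp (ln x)" "\<lambda>x. x"]
  by (simp add: herm_log_def herm_exp_def herm_fun_comp posdef_hermitian herm_fun_id)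

lemma herm_powr_exp: "hermitian H \<Longrightarrow> herm_powr (herm_exp H) t = herm_exp (t *\<^sub>R H)"
  unfolding herm_powr_def herm_exp_def
  by (subst herm_fun_scaleR[symmetric]) (simp_all add: herm_fun_comp powr_def)

lemma herm_powr_eq_exp: "A \<in> posdef \<Longrightarrow> herm_powr A t = herm_exp (t *\<^sub>R herm_log A)"
  by (metis herm_exp_log herm_powr_exp hermitian_herm_log)

lemma trace_norm2_hermitian: "hermitian H \<Longrightarrow> trace_norm2 H = norm H"
  by (simp add: trace_norm2_def hermitian_def norm_eq_sqrt_inner inner_eq_trace)

section \<open>Pairs of Hermitian matrices\<close>

text \<open>By cyclicity the trace only involves the two diagonals and the change of basis
  \<open>cadjoint U ** V\<close>, each entry of which meets its own conjugate.\<close>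

lemma trace_diag_mult_diag:
  assumes "unitary U" "unitary V"
  shows "Re (trace ((U ** real_diag f ** cadjoint U) ** (V ** real_diag g ** cadjoint V)))
       = (\<Sum>i\<in>UNIV. \<Sum>j\<in>UNIV. (cmod ((cadjoint U ** V) $ i $ j))\<^sup>2 * (f i * g j))"
proof -
  let ?W = "cadjoint U ** V"
  have "trace ((U ** real_diag f ** cadjoint U) ** (V ** real_diag g ** cadjoint V))
      = trace (real_diag f ** ?W ** real_diag g ** cadjoint ?W)"
    unfolding matrix_mul_assoc[symmetric]
    by (subst trace_mul_sym) (simp add: cadjoint_mult matrix_mul_assoc)
  also have "\<dots> = (\<Sum>i\<in>UNIV. \<Sum>j\<in>UNIV. complex_of_real (f i) * ?W $ i $ j * complex_of_real (g j)
                  * cnj (?W $ i $ j))"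
    unfolding trace_def
    by (subst matrix_matrix_mult_def) (simp add: mult_real_diag_component)
  also have "\<dots> = (\<Sum>i\<in>UNIV. \<Sum>j\<in>UNIV. complex_of_real ((cmod (?W $ i $ j))\<^sup>2 * (f i * g j)))"
    by (simp add: complex_norm_square mult_ac del: of_real_power)
  finally show ?thesis by simp
qed

lemma unitary_row_sum:
  assumes "unitary W"
  shows "(\<Sum>j\<in>UNIV. (cmod (W $ i $ j))\<^sup>2) = 1"
proof -
  have "(W ** cadjoint W) $ i $ i = (\<Sum>j\<in>UNIV. complex_of_real ((cmod (W $ i $ j))\<^sup>2))"
    by (simp add: matrix_matrix_mult_def complex_norm_square del: of_real_power)
  also have "W ** cadjoint W = mat 1" using assms by (simp add: unitary_def)
  finally show ?thesis
    by (simp add: mat_def del: of_real_power of_real_sum flip: of_real_sum)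
qed

lemma unitary_column_sum:
  assumes "unitary W"
  shows "(\<Sum>i\<in>UNIV. (cmod (W $ i $ j))\<^sup>2) = 1"
  using unitary_row_sum[OF unitary_cadjoint[OF assms], of j] by simp

text \<open>The weights \<open>w i j\<close> are the squared moduli of the entries of the unitary matrix that
  relates the two eigenbases.\<close>

locale spectral_pair =
  fixes H K :: "complex^'n^'n" and a b :: "'n \<Rightarrow> real" and w :: "'n \<Rightarrow> 'n \<Rightarrow> real"
  assumes herm: "hermitian H" "hermitian K"
    and w_nonneg: "0 \<le> w i j"
    and row_sum: "(\<Sum>j\<in>UNIV. w i j) = 1"
    and column_sum: "(\<Sum>i\<in>UNIV. w i j) = 1"
    and trace_mult: "Re (trace (herm_fun f H ** herm_fun g K))
        = (\<Sum>i\<in>UNIV. \<Sum>j\<in>UNIV. w i j * (f (a i) * g (b j)))"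
    and norm_diff: "(norm (herm_fun f H - herm_fun g K))\<^sup>2
        = (\<Sum>i\<in>UNIV. \<Sum>j\<in>UNIV. w i j * (f (a i) - g (b j))\<^sup>2)"
    and abs_a_le: "\<bar>a i\<bar> \<le> norm H"
    and abs_b_le: "\<bar>b j\<bar> \<le> norm K"
    and eigenvector: "\<exists>x. norm x = 1 \<and> herm_fun f K *v x = f (b j) *\<^sub>R x"
begin

lemma norm_diff_id: "(norm (H - K))\<^sup>2 = (\<Sum>i\<in>UNIV. \<Sum>j\<in>UNIV. w i j * (a i - b j)\<^sup>2)"
  using norm_diff[of "\<lambda>x. x" "\<lambda>x. x"] herm by (simp add: herm_fun_id)

end

lemma obtain_spectral_pair:
  fixes H K :: "complex^'n^'n"
  assumes "hermitian H" "hermitian K"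
  obtains a b w where "spectral_pair H K a b w"
proof -
  obtain U a where U: "unitary U" and H: "H = U ** real_diag a ** cadjoint U"
    using hermitian_diagonalizable[OF assms(1)] .
  obtain V b where V: "unitary V" and K: "K = V ** real_diag b ** cadjoint V"
    using hermitian_diagonalizable[OF assms(2)] .
  define w where "w i j = (cmod ((cadjoint U ** V) $ i $ j))\<^sup>2" for i j
  have W: "unitary (cadjoint U ** V)"
    using U V by (simp add: unitary_mult unitary_cadjoint)
  have row: "(\<Sum>j\<in>UNIV. w i j) = 1" and col: "(\<Sum>i\<in>UNIV. w i j) = 1" for i j
    unfolding w_def by (rule unitary_row_sum[OF W], rule unitary_column_sum[OF W])
  have tr: "Re (trace (herm_fun f H ** herm_fun g K))
        = (\<Sum>i\<in>UNIV. \<Sum>j\<in>UNIV. w i j * (f (a i) * g (b j)))" for f g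
    unfolding H K herm_fun_diagonalized[OF U] herm_fun_diagonalized[OF V]
      trace_diag_mult_diag[OF U V] w_def by simp
  have sq: "(norm (herm_fun f (X ** real_diag d ** cadjoint X)))\<^sup>2 = (\<Sum>i\<in>UNIV. (f (d i))\<^sup>2)"
    if "unitary X" for f d and X :: "complex^'n^'n"
    unfolding power2_norm_eq_inner inner_eq_trace herm_fun_diagonalized[OF that]
      hermitian_diag[unfolded hermitian_def] diag_mult[OF that] trace_diag[OF that]
    by (simp add: power2_eq_square)
  have nrm: "(norm (herm_fun f H - herm_fun g K))\<^sup>2
        = (\<Sum>i\<in>UNIV. \<Sum>j\<in>UNIV. w i j * (f (a i) - g (b j))\<^sup>2)" for f g
  proof -
    \<comment> \<open>Unit row sums spread the terms in \<open>f\<close> over \<open>j\<close> and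
      unit column sums spread those in \<open>g\<close> over \<open>i\<close>. All three parts of
      the expanded square then share the weights \<open>w i j\<close>.\<close>
    have 1: "(norm (herm_fun f H))\<^sup>2 = (\<Sum>i\<in>UNIV. \<Sum>j\<in>UNIV. w i j * (f (a i))\<^sup>2)"
      unfolding H sq[OF U] by (simp add: row flip: sum_distrib_right)
    have "(norm (herm_fun g K))\<^sup>2 = (\<Sum>j\<in>UNIV. \<Sum>i\<in>UNIV. w i j * (g (b j))\<^sup>2)"
      unfolding K sq[OF V] by (simp add: col flip: sum_distrib_right)
    also have "\<dots> = (\<Sum>i\<in>UNIV. \<Sum>j\<in>UNIV. w i j * (g (b j))\<^sup>2)"
      by (rule sum.swap)
    finally have 2: "(norm (herm_fun g K))\<^sup>2 = (\<Sum>i\<in>UNIV. \<Sum>j\<in>UNIV. w i j * (g (b j))\<^sup>2)" .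
    have 3: "herm_fun f H \<bullet> herm_fun g K = (\<Sum>i\<in>UNIV. \<Sum>j\<in>UNIV. w i j * (f (a i) * g (b j)))"
      using hermitian_herm_fun[OF assms(1), of f] tr[of f g]
      by (simp add: inner_eq_trace hermitian_def)
    have "(norm (herm_fun f H - herm_fun g K))\<^sup>2
      = (norm (herm_fun f H))\<^sup>2 + (norm (herm_fun g K))\<^sup>2 - 2 * (herm_fun f H \<bullet> herm_fun g K)"
      by (simp add: power2_norm_eq_inner inner_diff_left inner_diff_right inner_commute)
    then show ?thesis
      unfolding 1 2 3
      by (simp add: power2_diff algebra_simps sum.distrib sum_subtractf sum_distrib_left)
  qed
  have bd: "\<bar>d i\<bar> \<le> norm X" if X: "hermitian X" "X = Y ** real_diag d ** cadjoint Y" "unitary Y"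
    for d i and X Y :: "complex^'n^'n"
  proof -
    have "(d i)\<^sup>2 \<le> (\<Sum>i\<in>UNIV. (d i)\<^sup>2)"
      by (rule member_le_sum) auto
    also have "\<dots> = (norm X)\<^sup>2"
      using sq[OF X(3), of "\<lambda>x. x" d] X by (simp add: herm_fun_id)
    finally show ?thesis using power2_le_iff_abs_le[of "norm X" "d i"] by simp
  qed
  have "\<exists>x. norm x = 1 \<and> herm_fun f K *v x = f (b j) *\<^sub>R x" for f j
    using diag_eigenvector(1)[OF V, of j] diag_eigenvector(2)[OF V, where d = "f \<circ> b" and i = j]
    unfolding K herm_fun_diagonalized[OF V]
    by auto
  with assms row col tr nrm bd[OF assms(1) H U] bd[OF assms(2) K V] show ?thesis
    by (intro that[of a b w], unfold_locales) (auto simp: w_def)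
qed

text \<open>Pairing \<open>H\<close> with itself and taking the second function constant collapses
  the double sum, because the rows of weights sum to 1.\<close>

lemma spectral_single:
  fixes H :: "complex^'n^'n"
  assumes "hermitian H"
  obtains d :: "'n \<Rightarrow> real"
  where "\<And>f. Re (trace (herm_fun f H)) = (\<Sum>i\<in>UNIV. f (d i))"
    "(norm H)\<^sup>2 = (\<Sum>i\<in>UNIV. (d i)\<^sup>2)" "\<And>i. \<bar>d i\<bar> \<le> norm H"
proof -
  obtain a b w where "spectral_pair H H a b w"
    by (rule obtain_spectral_pair[OF assms assms])
  then interpret spectral_pair H H a b w .
  have 1: "Re (trace (herm_fun f H)) = (\<Sum>i\<in>UNIV. f (a i))" for f
    using trace_mult[of f "\<lambda>x. 1"]
    by (simp add: herm_fun_1 assms row_sum flip: sum_distrib_right)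
  have "(norm H)\<^sup>2 = Re (trace (herm_fun (\<lambda>x. x * x) H))"
    using assms
    by (simp add: power2_norm_eq_inner inner_eq_trace hermitian_def herm_fun_id flip: herm_fun_mult)
  also have "\<dots> = (\<Sum>i\<in>UNIV. (a i)\<^sup>2)" by (simp add: 1 power2_eq_square)
  finally show ?thesis using 1 abs_a_le by (intro that[of a])
qed

section \<open>Continuity of the exponential and the logarithm\<close>

text \<open>Both norms are sums over eigenvalue pairs with the same weights, so the scalar Lipschitz
  bound of \<open>exp\<close> below \<open>R\<close> applies term by term.\<close>

lemma herm_exp_lipschitz:
  fixes H K :: "complex^'n^'n"
  assumes "hermitian H" "hermitian K" "norm H \<le> R" "norm K \<le> R"
  shows "norm (herm_exp H - herm_exp K) \<le> exp R * norm (H - K)"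
proof -
  obtain a b w where "spectral_pair H K a b w"
    by (rule obtain_spectral_pair[OF assms(1,2)])
  then interpret spectral_pair H K a b w .
  have lip: "\<bar>exp x - exp y\<bar> \<le> exp R * \<bar>x - y\<bar>" if "x \<le> R" "y \<le> R" for x y :: real
  proof -
    have *: "exp x - exp y \<le> exp R * (x - y)" if "y \<le> x" "x \<le> R" for x y :: real
    proof -
      have "exp x - exp y = exp x * (1 - exp (y - x))"
        by (simp add: right_diff_distrib mult_exp_exp)
      also have "\<dots> \<le> exp R * (x - y)"
        using that exp_ge_add_one_self[of "y - x"] by (intro mult_mono) (simp, linarith, simp_all)
      finally show ?thesis .
    qed
    show ?thesis
      using *[of x y] *[of y x] that
      by (cases "y \<le> x") (auto simp: abs_if)
  qed
  have "(norm (herm_exp H - herm_exp K))\<^sup>2 = (\<Sum>i\<in>UNIV. \<Sum>j\<in>UNIV. w i j * (exp (a i) - exp (b j))\<^sup>2)"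
    by (simp add: herm_exp_def norm_diff)
  also have "\<dots> \<le> (\<Sum>i\<in>UNIV. \<Sum>j\<in>UNIV. w i j * (exp R * (a i - b j))\<^sup>2)"
  proof (intro sum_mono mult_left_mono w_nonneg)
    fix i j
    have "\<bar>exp (a i) - exp (b j)\<bar> \<le> \<bar>exp R * (a i - b j)\<bar>"
      using lip[of "a i" "b j"] abs_a_le[of i] abs_b_le[of j] assms by (simp add: abs_mult)
    then show "(exp (a i) - exp (b j))\<^sup>2 \<le> (exp R * (a i - b j))\<^sup>2"
      by (simp add: abs_le_square_iff)
  qed
  also have "\<dots> = (exp R * norm (H - K))\<^sup>2"
    by (simp add: norm_diff_id power_mult_distrib sum_distrib_left mult_ac)
  finally show ?thesis by (rule power2_le_imp_le) simp
qed

text \<open>The logarithm is Lipschitz only away from 0. The eigenvalues of \<open>A\<close> are at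
  least \<open>exp (- norm (herm_log A))\<close>, and nearness keeps those of \<open>B\<close> above
  half of this; then the scalar bound applies term by term.\<close>

lemma herm_log_lipschitz:
  fixes A B :: "complex^'n^'n"
  assumes "A \<in> posdef" "B \<in> posdef" and near: "norm (A - B) \<le> exp (- norm (herm_log A)) / 2"
  shows "norm (herm_log A - herm_log B) \<le> 2 * exp (norm (herm_log A)) * norm (A - B)"
proof -
  let ?R = "norm (herm_log A)"
  have h: "hermitian (herm_log A)" "hermitian (herm_log B)"
    using assms by (auto simp: hermitian_herm_log)
  obtain a b w where "spectral_pair (herm_log A) (herm_log B) a b w"
    by (rule obtain_spectral_pair[OF h])
  then interpret spectral_pair "herm_log A" "herm_log B" a b w .
  have nAB: "(norm (A - B))\<^sup>2 = (\<Sum>i\<in>UNIV. \<Sum>j\<in>UNIV. w i j * (exp (a i) - exp (b j))\<^sup>2)"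
    using norm_diff[of exp exp] herm_exp_log[OF assms(1)] herm_exp_log[OF assms(2)]
    by (simp add: herm_exp_def)
  have a_ge: "exp (a i) \<ge> exp (- ?R)" for i
    using abs_a_le[of i] by (auto simp: abs_le_iff)
  have b_ge: "exp (b j) \<ge> exp (- ?R) / 2" for j
  \<comment> \<open>Otherwise every \<open>exp (a i)\<close> is farther than
    \<open>exp (- ?R) / 2\<close> from \<open>exp (b j)\<close>. As the weights in column
    \<open>j\<close> sum to 1, this column alone would make \<open>norm (A - B)\<close> too
    large.\<close>
  proof (rule ccontr)
    assume *: "\<not> exp (b j) \<ge> exp (- ?R) / 2"
    have gt: "(exp (a i) - exp (b j))\<^sup>2 > (exp (- ?R) / 2)\<^sup>2" for i
      using a_ge[of i] * by (intro power_strict_mono) (linarith, auto)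
    have "(exp (- ?R) / 2)\<^sup>2 = (\<Sum>i\<in>UNIV. w i j * (exp (- ?R) / 2)\<^sup>2)"
      by (simp add: column_sum flip: sum_distrib_right)
    also have "\<dots> < (\<Sum>i\<in>UNIV. w i j * (exp (a i) - exp (b j))\<^sup>2)"
    proof -
      obtain i where "w i j \<noteq> 0"
        using column_sum[of j] by (metis sum.neutral zero_neq_one)
      then have "w i j > 0" using w_nonneg[of i j] by simp
      then have "w i j * (exp (- ?R) / 2)\<^sup>2 < w i j * (exp (a i) - exp (b j))\<^sup>2"
        using gt[of i] by simp
      moreover have "w i j * (exp (- ?R) / 2)\<^sup>2 \<le> w i j * (exp (a i) - exp (b j))\<^sup>2" for i
        using gt[of i] w_nonneg[of i j] by (intro mult_left_mono) auto
      ultimately show ?thesis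
        by (intro sum_strict_mono_ex1) auto
    qed
    also have "\<dots> \<le> (\<Sum>j\<in>UNIV. \<Sum>i\<in>UNIV. w i j * (exp (a i) - exp (b j))\<^sup>2)"
      by (rule member_le_sum[where f = "\<lambda>j. \<Sum>i\<in>UNIV. w i j * (exp (a i) - exp (b j))\<^sup>2"])
         (auto intro!: sum_nonneg mult_nonneg_nonneg w_nonneg)
    also have "\<dots> = (norm (A - B))\<^sup>2"
      unfolding nAB by (rule sum.swap)
    finally have "exp (- ?R) / 2 < norm (A - B)"
      by (rule power2_less_imp_less) simp
    then show False using near by simp
  qed
  let ?c = "exp (- ?R) / 2"
  have lip: "\<bar>x - y\<bar> \<le> \<bar>exp x - exp y\<bar> / ?c" if "exp x \<ge> ?c" "exp y \<ge> ?c" for x y :: real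
  proof -
    have *: "x - y \<le> (exp x - exp y) / ?c" if "y \<le> x" "exp y \<ge> ?c" for x y :: real
    proof -
      have "x - y \<le> exp (x - y) - 1"
        using exp_ge_add_one_self[of "x - y"] by linarith
      also have "\<dots> = (exp x - exp y) / exp y"
        by (simp add: exp_diff diff_divide_distrib)
      also have "\<dots> \<le> (exp x - exp y) / ?c"
        using that by (intro divide_left_mono) auto
      finally show ?thesis .
    qed
    show ?thesis
      using *[of x y] *[of y x] that
      by (cases "y \<le> x") (auto simp: abs_if)
  qed
  have c: "\<bar>x\<bar> / ?c = \<bar>2 * exp ?R * x\<bar>" for x
    by (simp add: exp_minus field_simps abs_mult)
  have "(norm (herm_log A - herm_log B))\<^sup>2 = (\<Sum>i\<in>UNIV. \<Sum>j\<in>UNIV. w i j * (a i - b j)\<^sup>2)"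
    by (rule norm_diff_id)
  also have "\<dots> \<le> (\<Sum>i\<in>UNIV. \<Sum>j\<in>UNIV. w i j * (2 * exp ?R * (exp (a i) - exp (b j)))\<^sup>2)"
  proof (intro sum_mono mult_left_mono w_nonneg)
    fix i j
    have "\<bar>a i - b j\<bar> \<le> \<bar>2 * exp ?R * (exp (a i) - exp (b j))\<bar>"
      using lip[of "a i" "b j"] a_ge[of i] b_ge[of j] exp_gt_zero[of "- ?R"]
      unfolding c by linarith
    then show "(a i - b j)\<^sup>2 \<le> (2 * exp ?R * (exp (a i) - exp (b j)))\<^sup>2"
      by (simp add: abs_le_square_iff)
  qed
  also have "\<dots> = (2 * exp ?R * norm (A - B))\<^sup>2"
    by (simp add: nAB power_mult_distrib sum_distrib_left mult_ac)
  finally show ?thesis by (rule power2_le_imp_le) simp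
qed

lemma continuous_on_herm_exp: "continuous_on {H :: complex^'n^'n. hermitian H} herm_exp"
  unfolding continuous_on_iff
proof (intro ballI allI impI, clarify)
  fix H :: "complex^'n^'n" and e :: real
  assume H: "hermitian H" and e: "e > 0"
  let ?C = "exp (norm H + 1)"
  show "\<exists>d>0. \<forall>K\<in>{H. hermitian H}. dist K H < d \<longrightarrow> dist (herm_exp K) (herm_exp H) < e"
  proof (intro exI[of _ "min 1 (e / ?C)"] conjI ballI impI)
    fix K :: "complex^'n^'n"
    assume K: "K \<in> {H. hermitian H}" and d: "dist K H < min 1 (e / ?C)"
    have "norm K \<le> norm H + norm (K - H)" using norm_triangle_ineq2[of K H] by simp
    then have "norm (herm_exp K - herm_exp H) \<le> ?C * norm (K - H)"
      using K H d by (intro herm_exp_lipschitz) (auto simp: dist_norm)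
    also have "\<dots> < e" using d by (simp add: dist_norm field_simps)
    finally show "dist (herm_exp K) (herm_exp H) < e" by (simp add: dist_norm)
  qed (use e in auto)
qed

lemma continuous_on_herm_log: "continuous_on (posdef :: (complex^'n^'n) set) herm_log"
  unfolding continuous_on_iff
proof (intro ballI allI impI)
  fix A :: "complex^'n^'n" and e :: real
  assume A: "A \<in> posdef" and e: "e > 0"
  let ?R = "norm (herm_log A)"
  show "\<exists>d>0. \<forall>B\<in>posdef. dist B A < d \<longrightarrow> dist (herm_log B) (herm_log A) < e"
  proof (intro exI[of _ "min (exp (- ?R) / 2) (e / (2 * exp ?R))"] conjI ballI impI)
    fix B :: "complex^'n^'n"
    assume B: "B \<in> posdef" and d: "dist B A < min (exp (- ?R) / 2) (e / (2 * exp ?R))"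
    have "norm (herm_log A - herm_log B) \<le> 2 * exp ?R * norm (A - B)"
      using A B d by (intro herm_log_lipschitz) (auto simp: dist_norm norm_minus_commute)
    also have "\<dots> < e"
      using d by (simp add: dist_norm norm_minus_commute field_simps)
    finally show "dist (herm_log B) (herm_log A) < e"
      by (simp add: dist_norm norm_minus_commute)
  qed (use e in auto)
qed

section \<open>The trace metric\<close>

lemma diff_exp_minus_ge:
  fixes y :: real
  assumes "0 \<le> y"
  shows "2 * y \<le> exp y - exp (- y)"
proof -
  have "(\<lambda>y. exp y - exp (- y) - 2 * y) 0 \<le> (\<lambda>y. exp y - exp (- y) - 2 * y) y"
  proof (rule DERIV_nonneg_imp_nondecreasing[OF assms])
    fix x :: real
    have "((\<lambda>y. exp y - exp (- y) - 2 * y) has_real_derivative exp x + exp (- x) - 2) (at x)"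
      by (auto intro!: derivative_eq_intros)
    moreover have "exp x + exp (- x) - 2 \<ge> 0"
      using exp_ge_add_one_self[of x] exp_ge_add_one_self[of "- x"] by linarith
    ultimately show "\<exists>z. ((\<lambda>y. exp y - exp (- y) - 2 * y) has_real_derivative z) (at x) \<and> 0 \<le> z"
      by blast
  qed
  then show ?thesis by simp
qed

text \<open>This is h(x) = 4 sinh(x/2)^2. Both bounds on h thereby become linear bounds on the
  difference of two exponentials.\<close>

lemma exp_sum_eq_square: "exp x + exp (- x) - 2 = (exp (x / 2) - exp (- (x / 2)))\<^sup>2" for x :: real
  by (simp add: power2_diff flip: exp_double exp_add)

lemma square_le_exp_sum: "x\<^sup>2 \<le> exp x + exp (- x) - 2" for x :: real
proof -
  have *: "x\<^sup>2 \<le> exp x + exp (- x) - 2" if "x \<ge> 0" for x :: real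
    unfolding exp_sum_eq_square using diff_exp_minus_ge[of "x / 2"] that
    by (intro power_mono) auto
  show ?thesis using *[of x] *[of "- x"] by (cases "x \<ge> 0") (auto simp: add.commute)
qed

text \<open>Factoring \<open>exp (x / 2)\<close> out of the root of h leaves
  \<open>1 - exp (- x)\<close>, which is at most \<open>x\<close>; evenness of h covers negative
  arguments.\<close>

lemma exp_sum_le: "exp x + exp (- x) - 2 \<le> x\<^sup>2 * exp \<bar>x\<bar>" for x :: real
proof -
  have *: "exp x + exp (- x) - 2 \<le> x\<^sup>2 * exp x" if "x \<ge> 0" for x :: real
  proof -
    have "exp (x / 2) - exp (- (x / 2)) = exp (x / 2) * (1 - exp (- x))"
      by (simp add: right_diff_distrib mult_exp_exp)
    also have "\<dots> \<le> exp (x / 2) * x"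
      using exp_ge_add_one_self[of "- x"] by (intro mult_left_mono) auto
    finally have "(exp (x / 2) - exp (- (x / 2)))\<^sup>2 \<le> (exp (x / 2) * x)\<^sup>2"
      using that by (intro power_mono) auto
    also have "\<dots> = x\<^sup>2 * exp x"
      by (simp add: power_mult_distrib flip: exp_double)
    finally show ?thesis unfolding exp_sum_eq_square .
  qed
  show ?thesis using *[of x] *[of "- x"] by (cases "x \<ge> 0") (auto simp: add.commute)
qed

section \<open>The trace gap\<close>

text \<open>The quantity Q of the overview at \<open>herm_exp H\<close> and
  \<open>herm_exp K\<close>. In logarithmic coordinates inverses become sign changes, and everything
  is in the functional calculus of \<open>H\<close> and \<open>K\<close>.\<close>

definition trace_gap :: "complex^'n^'n \<Rightarrow> complex^'n^'n \<Rightarrow> real" where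
  "trace_gap H K = Re (trace (herm_exp (- H) ** herm_exp K)) + Re (trace (herm_exp (- K) ** herm_exp H))
     - 2 * CARD('n)"

lemma herm_exp_scaleR: "hermitian H \<Longrightarrow> herm_exp (t *\<^sub>R H) = herm_fun (\<lambda>x. exp (t * x)) H"
  using herm_fun_scaleR[of H t] herm_fun_comp[of H exp "\<lambda>x. t * x"] by (simp add: herm_exp_def)

lemma herm_exp_uminus: "hermitian H \<Longrightarrow> herm_exp (- H) = herm_fun (\<lambda>x. exp (- x)) H"
  using herm_exp_scaleR[of H "-1"] by simp

context spectral_pair
begin

lemma trace_gap_scaleR:
  "trace_gap (t *\<^sub>R H) (t *\<^sub>R K)
    = (\<Sum>i\<in>UNIV. \<Sum>j\<in>UNIV. w i j * (exp (t * (b j - a i)) + exp (- (t * (b j - a i))) - 2))"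
proof -
  have "Re (trace (herm_exp (- (t *\<^sub>R K)) ** herm_exp (t *\<^sub>R H)))
      = Re (trace (herm_exp (t *\<^sub>R H) ** herm_exp (- (t *\<^sub>R K))))"
    by (subst trace_mul_sym) (rule refl)
  \<comment> \<open>The total weight is \<open>CARD('n)\<close>, so the constant can be distributed
    over the eigenvalue pairs.\<close>
  moreover have "2 * real CARD('n) = (\<Sum>i\<in>UNIV. \<Sum>j\<in>UNIV. w i j * 2)"
    by (simp add: row_sum flip: sum_distrib_right)
  moreover have "w i j * (exp (t * (b j - a i)) + exp (- (t * (b j - a i))) - 2)
      = w i j * (exp (- t * a i) * exp (t * b j)) + w i j * (exp (t * a i) * exp (- t * b j)) - w i j * 2"
    for i j
    unfolding mult_exp_exp by (simp add: distrib_left right_diff_distrib)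
  ultimately show ?thesis
    unfolding trace_gap_def scaleR_minus_left[symmetric] herm_exp_scaleR[OF herm(1)]
      herm_exp_scaleR[OF herm(2)] trace_mult
    by (simp only: sum.distrib sum_subtractf)
qed

lemma trace_gap_eq:
  "trace_gap H K = (\<Sum>i\<in>UNIV. \<Sum>j\<in>UNIV. w i j * (exp (b j - a i) + exp (- (b j - a i)) - 2))"
  using trace_gap_scaleR[of 1] by simp

lemma trace_gap_scaleR_le:
  "trace_gap (t *\<^sub>R H) (t *\<^sub>R K)
    \<le> t\<^sup>2 * (\<Sum>i\<in>UNIV. \<Sum>j\<in>UNIV. w i j * ((a i - b j)\<^sup>2 * exp (\<bar>t\<bar> * \<bar>a i - b j\<bar>)))"
proof -
  have "exp (t * (b j - a i)) + exp (- (t * (b j - a i))) - 2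
      \<le> t\<^sup>2 * ((a i - b j)\<^sup>2 * exp (\<bar>t\<bar> * \<bar>a i - b j\<bar>))" for i j
    using exp_sum_le[of "t * (b j - a i)"]
    by (simp add: power_mult_distrib abs_mult power2_commute abs_minus_commute mult.assoc)
  then have "trace_gap (t *\<^sub>R H) (t *\<^sub>R K)
    \<le> (\<Sum>i\<in>UNIV. \<Sum>j\<in>UNIV. w i j * (t\<^sup>2 * ((a i - b j)\<^sup>2 * exp (\<bar>t\<bar> * \<bar>a i - b j\<bar>))))"
    unfolding trace_gap_scaleR by (intro sum_mono mult_left_mono w_nonneg)
  then show ?thesis by (simp add: sum_distrib_left mult.left_commute)
qed

end

lemma norm_diff_le_trace_gap:
  assumes "hermitian H" "hermitian K"
  shows "(norm (H - K))\<^sup>2 \<le> trace_gap H K"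
proof -
  obtain a b w where "spectral_pair H K a b w"
    by (rule obtain_spectral_pair[OF assms])
  then interpret spectral_pair H K a b w .
  show ?thesis
    unfolding trace_gap_eq norm_diff_id
    by (intro sum_mono mult_left_mono w_nonneg) (metis power2_commute square_le_exp_sum)
qed

section \<open>Comparison of the trace gap with the trace metric\<close>

lemma inverse_unique_right:
  fixes A :: "complex^'n^'n"
  assumes "A ** B = mat 1" "A ** C = mat 1"
  shows "B = C"
  by (metis assms matrix_left_right_inverse matrix_mul_assoc matrix_mul_lid matrix_mul_rid)

lemma herm_exp_minus_log:
  assumes "A \<in> posdef" "A ** A' = mat 1"
  shows "herm_exp (- herm_log A) = A'"
  by (metis assms herm_exp_inverse(1) herm_exp_log hermitian_herm_log inverse_unique_right)

lemma trace_gap_log: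
  fixes A B :: "complex^'n^'n"
  assumes "A \<in> posdef" "B \<in> posdef" "A ** A' = mat 1" "B ** B' = mat 1"
  shows "trace_gap (herm_log A) (herm_log B)
       = Re (trace (A' ** B)) + Re (trace (B' ** A)) - 2 * CARD('n)"
  using assms by (simp add: trace_gap_def herm_exp_minus_log herm_exp_log)

lemma posdef_square_root:
  fixes A :: "complex^'n^'n"
  assumes "A \<in> posdef"
  obtains R R' where "R ** R = A" "R ** R' = mat 1" "R' ** R = mat 1" "cadjoint R = R"
    "cadjoint R' = R'" "R' = herm_powr A (- 1 / 2)" "R' ** A ** R' = mat 1"
proof -
  define R where "R = herm_exp ((1/2) *\<^sub>R herm_log A)"
  define R' where "R' = herm_exp ((-1/2) *\<^sub>R herm_log A)"
  have h: "hermitian (herm_log A)" using assms by (rule hermitian_herm_log)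
  have 1: "R ** R = A" "R ** R' = mat 1" "R' ** R = mat 1"
    unfolding R_def R'_def herm_exp_mult[OF h] by (simp_all add: herm_exp_0 herm_exp_log assms)
  have "cadjoint R = R" "cadjoint R' = R'"
    unfolding R_def R'_def
    by (rule hermitian_herm_exp[OF hermitian_scaleR[OF h], unfolded hermitian_def])+
  moreover have "R' = herm_powr A (- 1 / 2)"
    unfolding R'_def by (simp add: herm_powr_eq_exp assms)
  moreover have "R' ** A ** R' = mat 1"
    by (metis 1 matrix_mul_assoc matrix_mul_lid)
  ultimately show ?thesis using 1 that by blast
qed

lemma trace_dist_square_root:
  assumes "B \<in> posdef" "R' = herm_powr A (- 1 / 2)" "cadjoint R' = R'" "R' ** R = mat 1"
  shows "R' ** B ** R' \<in> posdef" "trace_dist A B = norm (herm_log (R' ** B ** R'))"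
proof -
  show *: "R' ** B ** R' \<in> posdef"
    using posdef_congruence[OF assms(1,4)] assms(3) by simp
  have "trace_dist A B = trace_norm2 (herm_log (R' ** B ** R'))"
    by (simp add: trace_dist_def assms(2))
  then show "trace_dist A B = norm (herm_log (R' ** B ** R'))"
    by (simp add: trace_norm2_hermitian hermitian_herm_log *)
qed

text \<open>With D denoting A^(-1/2) B A^(-1/2), cyclicity gives tr D = tr A^(-1) B and tr D^(-1) =
  tr B^(-1) A. The gap is therefore the sum of h over the eigenvalues of log D, while the squared
  distance is the sum of their squares.\<close>

lemma trace_dist_le_trace_gap:
  fixes A B :: "complex^'n^'n"
  assumes A: "A \<in> posdef" and B: "B \<in> posdef"
  shows "(trace_dist A B)\<^sup>2 \<le> trace_gap (herm_log A) (herm_log B)"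
proof -
  obtain R R' where R: "R ** R = A" "R ** R' = mat 1" "R' ** R = mat 1" "cadjoint R' = R'"
    "R' = herm_powr A (- 1 / 2)"
    using posdef_square_root[OF A] by metis
  define D where "D = R' ** B ** R'"
  note D = trace_dist_square_root[OF B R(5,4,3), folded D_def]
  obtain B' where B': "B ** B' = mat 1"
    using herm_exp_inverse(1)[OF hermitian_herm_log[OF B]] herm_exp_log[OF B] by metis
  have canc: "R' ** (R ** X) = X" "R ** (R' ** X) = X" "B ** (B' ** X) = X" for X :: "complex^'n^'n"
    using R(2,3) B' by (simp_all add: matrix_mul_assoc)
  have D': "D ** (R ** B' ** R) = mat 1"
    by (simp add: D_def R(2,3) canc flip: matrix_mul_assoc)
  have A': "A ** (R' ** R') = mat 1"
    by (simp add: canc R(2,3) flip: matrix_mul_assoc R(1))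
  have tr1: "trace D = trace (R' ** R' ** B)"
    unfolding D_def matrix_mul_assoc[symmetric] by (subst trace_mul_sym) (simp add: matrix_mul_assoc)
  have tr2: "trace (R ** B' ** R) = trace (B' ** A)"
    unfolding R(1)[symmetric] matrix_mul_assoc[symmetric]
    by (subst trace_mul_sym) (simp add: matrix_mul_assoc)
  have hL: "hermitian (herm_log D)" using D(1) by (rule hermitian_herm_log)
  obtain d :: "'n \<Rightarrow> real" where d: "\<And>f. Re (trace (herm_fun f (herm_log D))) = (\<Sum>i\<in>UNIV. f (d i))"
      and nd: "(norm (herm_log D))\<^sup>2 = (\<Sum>i\<in>UNIV. (d i)\<^sup>2)"
    by (rule spectral_single[OF hL]) (rule that)
  have "(trace_dist A B)\<^sup>2 = (\<Sum>i\<in>UNIV. (d i)\<^sup>2)" by (simp add: D(2) nd)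
  also have "\<dots> \<le> (\<Sum>i\<in>UNIV. exp (d i) + exp (- d i) - 2)"
    by (intro sum_mono square_le_exp_sum)
  also have "\<dots> = Re (trace (herm_exp (herm_log D))) + Re (trace (herm_exp (- herm_log D)))
      - 2 * CARD('n)"
    unfolding herm_exp_uminus[OF hL] unfolding herm_exp_def d
    by (simp add: sum.distrib sum_subtractf)
  also have "\<dots> = trace_gap (herm_log A) (herm_log B)"
    unfolding trace_gap_log[OF A B A' B'] herm_exp_minus_log[OF D(1) D'] herm_exp_log[OF D(1)]
      tr1 tr2 ..
  finally show ?thesis .
qed

text \<open>The curve \<open>G\<close> below is the geodesic from \<open>A\<close> to \<open>B\<close>. On a piece of parameter length \<open>u\<close> the bound
  \<open>norm_diff_le_trace_gap\<close> loses at most the factor \<open>exp (u \<parallel>L\<parallel> / 2)\<close>, which tends to 1.\<close>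

theorem norm_log_diff_le_trace_dist:
  fixes A B :: "complex^'n^'n"
  assumes A: "A \<in> posdef" and B: "B \<in> posdef"
  shows "norm (herm_log A - herm_log B) \<le> trace_dist A B"
proof -
  obtain R R' where R: "R ** R = A" "R ** R' = mat 1" "R' ** R = mat 1" "cadjoint R = R"
    "cadjoint R' = R'" "R' = herm_powr A (- 1 / 2)"
    using posdef_square_root[OF A] by metis
  define D where "D = R' ** B ** R'"
  note D = trace_dist_square_root[OF B R(6,5,3), folded D_def]
  define L where "L = herm_log D"
  have hL: "hermitian L" unfolding L_def using D(1) by (rule hermitian_herm_log)
  have hsL: "hermitian (s *\<^sub>R L)" for s using hL by (rule hermitian_scaleR)
  have R_canc: "R' ** (R ** X) = X" "R ** (R' ** X) = X" for X :: "complex^'n^'n"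
    using R(2,3) by (simp_all add: matrix_mul_assoc)
  have exp_canc: "herm_exp (s *\<^sub>R L) ** (herm_exp (t *\<^sub>R L) ** X) = herm_exp ((s + t) *\<^sub>R L) ** X"
    for s t and X :: "complex^'n^'n"
    by (simp add: herm_exp_mult[OF hL] matrix_mul_assoc)
  define G where "G s = R ** herm_exp (s *\<^sub>R L) ** R" for s :: real
  define G' where "G' s = R' ** herm_exp ((- s) *\<^sub>R L) ** R'" for s :: real
  have G: "G s \<in> posdef" for s
    using posdef_congruence[OF posdef_herm_exp[OF hsL[of s]] R(2)] by (simp add: G_def R(4))
  have GG': "G s ** G' s = mat 1" for s
    unfolding G_def G'_def matrix_mul_assoc[symmetric] R_canc exp_canc
    by (simp add: herm_exp_0 R(1-3))
  have G0: "G 0 = A" by (simp add: G_def herm_exp_0 R(1-3))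
  have G1: "G 1 = B"
    by (simp add: G_def L_def herm_exp_log D(1))
      (simp add: D_def R_canc R(2,3) flip: matrix_mul_assoc)
  obtain d :: "'n \<Rightarrow> real" where d: "\<And>f. Re (trace (herm_fun f L)) = (\<Sum>i\<in>UNIV. f (d i))"
      and nd: "(norm L)\<^sup>2 = (\<Sum>i\<in>UNIV. (d i)\<^sup>2)" and d_le: "\<And>i. \<bar>d i\<bar> \<le> norm L"
    by (rule spectral_single[OF hL]) (rule that)
  have tr: "Re (trace (herm_exp (u *\<^sub>R L))) = (\<Sum>i\<in>UNIV. exp (u * d i))" for u
    unfolding herm_exp_def herm_fun_scaleR[OF hL, symmetric] herm_fun_comp[OF hL] d ..
  \<comment> \<open>Cyclicity removes \<open>R\<close> and \<open>R'\<close>, so the gap between two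
    points of the curve depends only on their parameter difference.\<close>
  have trG: "trace (G' s ** G t) = trace (herm_exp ((t - s) *\<^sub>R L))" for s t
  proof -
    have "G' s ** G t = R' ** (herm_exp ((t - s) *\<^sub>R L) ** R)"
      unfolding G_def G'_def matrix_mul_assoc[symmetric] R_canc exp_canc by simp
    then show ?thesis
      by (metis R(2) matrix_mul_assoc matrix_mul_rid trace_mul_sym)
  qed
  have step: "norm (herm_log (G s) - herm_log (G (s + u))) \<le> u * norm L * exp (u * norm L / 2)"
    if u: "u \<ge> 0" for s u
  proof (rule power2_le_imp_le)
    have "(norm (herm_log (G s) - herm_log (G (s + u))))\<^sup>2
        \<le> trace_gap (herm_log (G s)) (herm_log (G (s + u)))"
      by (intro norm_diff_le_trace_gap hermitian_herm_log G)
    also have "\<dots> = (\<Sum>i\<in>UNIV. exp (u * d i) + exp (- (u * d i)) - 2)"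
      unfolding trace_gap_log[OF G G GG' GG'] trG tr by (simp add: sum.distrib sum_subtractf)
    also have "\<dots> \<le> (\<Sum>i\<in>UNIV. (u * d i)\<^sup>2 * exp (u * norm L))"
    proof (rule sum_mono)
      fix i
      have "\<bar>u * d i\<bar> \<le> u * norm L"
        using u d_le[of i] by (simp add: abs_mult mult_left_mono)
      then have "(u * d i)\<^sup>2 * exp \<bar>u * d i\<bar> \<le> (u * d i)\<^sup>2 * exp (u * norm L)"
        by (intro mult_left_mono) auto
      then show "exp (u * d i) + exp (- (u * d i)) - 2 \<le> (u * d i)\<^sup>2 * exp (u * norm L)"
        using exp_sum_le[of "u * d i"] by linarith
    qed
    also have "\<dots> = u\<^sup>2 * (norm L)\<^sup>2 * exp (u * norm L)"
      unfolding nd by (simp add: power_mult_distrib sum_distrib_left sum_distrib_right)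
    also have "\<dots> = (u * norm L * exp (u * norm L / 2))\<^sup>2"
      by (simp add: power_mult_distrib flip: exp_double)
    finally show "(norm (herm_log (G s) - herm_log (G (s + u))))\<^sup>2
        \<le> (u * norm L * exp (u * norm L / 2))\<^sup>2" .
  qed (use u in simp)
  \<comment> \<open>Cutting the parameter interval into \<open>Suc N\<close> equal pieces, the
    triangle inequality adds up the step bounds; only the exponential factor still depends on
    \<open>N\<close>.\<close>
  have chain: "norm (herm_log A - herm_log B) \<le> norm L * exp (inverse (real (Suc N)) * (norm L / 2))"
    for N
  proof -
    let ?u = "inverse (real (Suc N))"
    have tel: "herm_log (G 0) - herm_log (G (real n * ?u))
        = (\<Sum>k<n. herm_log (G (real k * ?u)) - herm_log (G (real (Suc k) * ?u)))" for n
      by (subst sum_lessThan_telescope') simp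
    have "norm (herm_log (G 0) - herm_log (G (real (Suc N) * ?u)))
        \<le> (\<Sum>k<Suc N. ?u * norm L * exp (?u * norm L / 2))"
      unfolding tel
    proof (rule sum_norm_le)
      fix k
      have "real (Suc k) * ?u = real k * ?u + ?u" by (simp add: distrib_right)
      then show "norm (herm_log (G (real k * ?u)) - herm_log (G (real (Suc k) * ?u)))
          \<le> ?u * norm L * exp (?u * norm L / 2)"
        using step[of ?u "real k * ?u"] by simp
    qed
    also have "\<dots> = norm L * exp (?u * (norm L / 2))"
      by simp
    finally show ?thesis
      by (simp add: G0 G1)
  qed
  have "(\<lambda>N. norm L * exp (inverse (real (Suc N)) * (norm L / 2))) \<longlonglongrightarrow> norm L * exp (0 * (norm L / 2))"
    by (intro tendsto_intros LIMSEQ_inverse_real_of_nat)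
  then have "norm (herm_log A - herm_log B) \<le> norm L * exp (0 * (norm L / 2))"
    by (rule LIMSEQ_le_const) (use chain in blast)
  then show ?thesis by (simp add: D(2) L_def)
qed

section \<open>Congruence invariance and the semi-parallelogram law\<close>

text \<open>With \<open>R\<close> and \<open>S\<close> the roots of the two base points,
  \<open>S' ** C ** R\<close> is unitary. It conjugates the matrices whose logarithms define the two
  distances.\<close>

lemma trace_dist_congruence:
  fixes A B C :: "complex^'n^'n"
  assumes A: "A \<in> posdef" and B: "B \<in> posdef" and C: "C ** C' = mat 1"
  shows "trace_dist (C ** A ** cadjoint C) (C ** B ** cadjoint C) = trace_dist A B"
proof -
  let ?A = "C ** A ** cadjoint C" and ?B = "C ** B ** cadjoint C"
  have pos: "?A \<in> posdef" "?B \<in> posdef"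
    using posdef_congruence[OF _ C] A B by auto
  obtain R R' where R: "R ** R = A" "R ** R' = mat 1" "R' ** R = mat 1" "cadjoint R = R"
    "cadjoint R' = R'" "R' = herm_powr A (- 1 / 2)"
    using posdef_square_root[OF A] by metis
  obtain S S' where S: "S ** S = ?A" "S ** S' = mat 1" "S' ** S = mat 1" "cadjoint S = S"
    "cadjoint S' = S'" "S' = herm_powr ?A (- 1 / 2)" "S' ** ?A ** S' = mat 1"
    by (rule posdef_square_root[OF pos(1)]) (rule that)
  note 1 = trace_dist_square_root[OF B R(6,5,3)]
  note 2 = trace_dist_square_root[OF pos(2) S(6,5,3)]
  have R_canc: "R' ** (R ** X) = X" "R ** (R' ** X) = X" for X :: "complex^'n^'n"
    using R(2,3) by (simp_all add: matrix_mul_assoc)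
  define U where "U = S' ** C ** R"
  have "U ** cadjoint U = S' ** (C ** (R ** R) ** cadjoint C) ** S'"
    by (simp add: U_def cadjoint_mult S(5) R(4) flip: matrix_mul_assoc)
  then have "U ** cadjoint U = mat 1" by (simp only: R(1) S(7))
  then have U: "unitary U"
    by (simp add: unitary_def matrix_left_right_inverse)
  have "S' ** ?B ** S' = U ** (R' ** B ** R') ** cadjoint U"
    by (simp add: U_def cadjoint_mult S(5) R(4) R_canc flip: matrix_mul_assoc)
  then have "herm_log (S' ** ?B ** S') = U ** herm_log (R' ** B ** R') ** cadjoint U"
    by (simp add: herm_log_def herm_fun_unitary_conj U posdef_hermitian 1)
  then show ?thesis
    by (simp add: 1 2 norm_unitary_mult U unitary_cadjoint)
qed

lemma herm_powr_mat_1: "herm_powr (mat 1) t = mat 1"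
proof -
  have "hermitian (0 :: complex^'n^'n)" by (simp add: hermitian_def vec_eq_iff)
  from herm_powr_exp[OF this] show ?thesis by (simp add: herm_exp_0)
qed

text \<open>At the identity the metric increasing inequality is an equality, which is what makes the
  midpoint argument work.\<close>

lemma trace_dist_mat_1: "X \<in> posdef \<Longrightarrow> trace_dist (mat 1) X = norm (herm_log X)"
  by (simp add: trace_dist_def herm_powr_mat_1 trace_norm2_hermitian hermitian_herm_log)

text \<open>A congruence moves the midpoint to the identity. There the distance from
  \<open>M\<close> is exactly a norm of logarithms, those from \<open>A\<close> and \<open>B\<close>
  are at least such norms, and the Euclidean parallelogram law applies. The gain \<open>c\<close> is
  the same for all \<open>X\<close>, so it survives integration.\<close>

lemma trace_dist_midpoint:
  fixes A B :: "complex^'n^'n"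
  assumes A: "A \<in> posdef" and B: "B \<in> posdef" and "A \<noteq> B"
  obtains M c where "M \<in> posdef" "c > 0"
    "\<And>X. X \<in> posdef \<Longrightarrow> (trace_dist M X)\<^sup>2 \<le> ((trace_dist A X)\<^sup>2 + (trace_dist B X)\<^sup>2) / 2 - c"
proof -
  obtain R R' where R: "R ** R = A" "R ** R' = mat 1" "R' ** R = mat 1" "cadjoint R = R"
    "cadjoint R' = R'" "R' = herm_powr A (- 1 / 2)"
    using posdef_square_root[OF A] by metis
  have R_canc: "R' ** (R ** X) = X" "R ** (R' ** X) = X" for X :: "complex^'n^'n"
    using R(2,3) by (simp_all add: matrix_mul_assoc)
  define D where "D = R' ** B ** R'"
  have D: "D \<in> posdef" unfolding D_def by (rule trace_dist_square_root(1)[OF B R(6,5,3)])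
  define L where "L = herm_log D"
  have hL: "hermitian L" unfolding L_def using D by (rule hermitian_herm_log)
  have D_eq: "D = herm_exp (1 *\<^sub>R L)" by (simp add: L_def herm_exp_log D)
  have B_eq: "B = R ** D ** R"
    by (simp add: D_def R_canc R(2,3) flip: matrix_mul_assoc)
  define Q where "Q s = herm_exp (s *\<^sub>R L)" for s :: real
  have hQ: "cadjoint (Q s) = Q s" for s
    using hermitian_herm_exp[OF hermitian_scaleR[OF hL]] by (simp add: Q_def hermitian_def)
  have Q_mult: "Q s ** Q t = Q (s + t)" "Q s ** (Q t ** X) = Q (s + t) ** X" for s t and X :: "complex^'n^'n"
    by (simp_all add: Q_def herm_exp_mult[OF hL] matrix_mul_assoc)
  have Q0: "Q 0 = mat 1" by (simp add: Q_def herm_exp_0)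
  have Q1: "D = Q 1" unfolding Q_def by (rule D_eq)
  have Qpos: "Q s \<in> posdef" for s
    unfolding Q_def by (intro posdef_herm_exp hermitian_scaleR hL)
  have logQ: "herm_log (Q s) = s *\<^sub>R L" for s
    unfolding Q_def by (intro herm_log_exp hermitian_scaleR hL)
  \<comment> \<open>Undoing the root of \<open>A\<close> and then a quarter of the way along
    \<open>L\<close> on each side sends \<open>A\<close>, \<open>M\<close>, \<open>B\<close> to
    \<open>Q (- 1/2)\<close>, the identity and \<open>Q (1/2)\<close>, symmetric about the
    identity.\<close>
  define C where "C = Q (- 1/4) ** R'"
  have C: "C ** (R ** Q (1/4)) = mat 1"
    by (simp add: C_def R_canc Q_mult Q0 flip: matrix_mul_assoc)
  define M where "M = R ** Q (1/2) ** R"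
  have M: "M \<in> posdef"
    using posdef_congruence[OF Qpos R(2), of "1/2"] by (simp add: M_def R(4))
  have CA: "C ** A ** cadjoint C = Q (- 1/2)" and CB: "C ** B ** cadjoint C = Q (1/2)"
    and CM: "C ** M ** cadjoint C = mat 1"
    unfolding B_eq Q1 M_def R(1)[symmetric]
    by (simp_all add: C_def cadjoint_mult hQ R(2-5) R_canc Q_mult Q0 flip: matrix_mul_assoc)
  have "L \<noteq> 0"
  proof
    assume "L = 0"
    then have "B = A" by (simp add: B_eq D_eq herm_exp_0 R(1-3))
    with \<open>A \<noteq> B\<close> show False by simp
  qed
  have ineq: "(trace_dist M X)\<^sup>2 \<le> ((trace_dist A X)\<^sup>2 + (trace_dist B X)\<^sup>2) / 2 - (norm L)\<^sup>2 / 4"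
    if X: "X \<in> posdef" for X
  proof -
    let ?X = "C ** X ** cadjoint C"
    have X': "?X \<in> posdef" using X C by (rule posdef_congruence)
    let ?K = "herm_log ?X"
    have dM: "trace_dist M X = norm ?K"
      using trace_dist_congruence[OF M X C] by (simp add: CM trace_dist_mat_1 X')
    have dA: "norm ((- 1/2) *\<^sub>R L - ?K) \<le> trace_dist A X"
      using trace_dist_congruence[OF A X C] norm_log_diff_le_trace_dist[OF Qpos[of "- 1/2"] X']
      by (simp add: CA logQ)
    have dB: "norm ((1/2) *\<^sub>R L - ?K) \<le> trace_dist B X"
      using trace_dist_congruence[OF B X C] norm_log_diff_le_trace_dist[OF Qpos[of "1/2"] X']
      by (simp add: CB logQ)
    have "(norm ?K)\<^sup>2 = ((norm ((- 1/2) *\<^sub>R L - ?K))\<^sup>2 + (norm ((1/2) *\<^sub>R L - ?K))\<^sup>2) / 2 - (norm L)\<^sup>2 / 4"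
      unfolding power2_norm_eq_inner
      by (simp add: inner_diff_left inner_diff_right inner_commute field_simps)
    also have "\<dots> \<le> ((trace_dist A X)\<^sup>2 + (trace_dist B X)\<^sup>2) / 2 - (norm L)\<^sup>2 / 4"
      using power_mono[OF dA, of 2] power_mono[OF dB, of 2] by simp
    finally show ?thesis by (simp add: dM)
  qed
  show ?thesis
    by (rule that[OF M _ ineq]) (use \<open>L \<noteq> 0\<close> in auto)
qed

section \<open>The trace metric near the identity\<close>

lemma trace_dist_exp_le_trace_gap:
  assumes "hermitian H" "hermitian K"
  shows "(trace_dist (herm_exp H) (herm_exp K))\<^sup>2 \<le> trace_gap H K"
  using trace_dist_le_trace_gap[of "herm_exp H" "herm_exp K"] assms
  by (simp add: posdef_herm_exp herm_log_exp)

lemma norm_diff_le_trace_dist_exp: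
  assumes "hermitian H" "hermitian K"
  shows "norm (H - K) \<le> trace_dist (herm_exp H) (herm_exp K)"
  using norm_log_diff_le_trace_dist[of "herm_exp H" "herm_exp K"] assms
  by (simp add: posdef_herm_exp herm_log_exp)

text \<open>A crude bound that separates out the factor \<open>t\<^sup>2\<close>. It supplies the
  dominating functions, at \<open>t = 1\<close> for the objective and at small \<open>t\<close> for
  the limit.\<close>

lemma trace_dist_exp_scaleR_le:
  fixes H K :: "complex^'n^'n"
  assumes "hermitian H" "hermitian K"
  shows "(trace_dist (herm_exp (t *\<^sub>R H)) (herm_exp (t *\<^sub>R K)))\<^sup>2
    \<le> t\<^sup>2 * (CARD('n) * ((norm H + norm K)\<^sup>2 * exp (\<bar>t\<bar> * (norm H + norm K))))"
proof -
  obtain a b w where "spectral_pair H K a b w"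
    by (rule obtain_spectral_pair[OF assms])
  then interpret spectral_pair H K a b w .
  have "(trace_dist (herm_exp (t *\<^sub>R H)) (herm_exp (t *\<^sub>R K)))\<^sup>2 \<le> trace_gap (t *\<^sub>R H) (t *\<^sub>R K)"
    by (intro trace_dist_exp_le_trace_gap hermitian_scaleR assms)
  also have "\<dots> \<le> t\<^sup>2 * (\<Sum>i\<in>UNIV. \<Sum>j\<in>UNIV. w i j * ((a i - b j)\<^sup>2 * exp (\<bar>t\<bar> * \<bar>a i - b j\<bar>)))"
    by (rule trace_gap_scaleR_le)
  also have "\<dots> \<le> t\<^sup>2 * (\<Sum>i\<in>UNIV. \<Sum>j\<in>UNIV. w i j * ((norm H + norm K)\<^sup>2 * exp (\<bar>t\<bar> * (norm H + norm K))))"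
  proof (intro mult_left_mono sum_mono w_nonneg mult_mono)
    fix i j
    have *: "\<bar>a i - b j\<bar> \<le> norm H + norm K"
      using abs_a_le[of i] abs_b_le[of j] by linarith
    show "(a i - b j)\<^sup>2 \<le> (norm H + norm K)\<^sup>2"
      using power_mono[OF *, of 2] by simp
    show "exp (\<bar>t\<bar> * \<bar>a i - b j\<bar>) \<le> exp (\<bar>t\<bar> * (norm H + norm K))"
      using * by (simp add: mult_left_mono)
  qed auto
  also have "\<dots> = t\<^sup>2 * (CARD('n) * ((norm H + norm K)\<^sup>2 * exp (\<bar>t\<bar> * (norm H + norm K))))"
    by (simp add: row_sum flip: sum_distrib_right)
  finally show ?thesis .
qed

text \<open>The metric is Euclidean to first order at the identity: the metric increasing property
  bounds the quotient from below, the trace gap from above, and the excess factors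
  \<open>exp (\<bar>t\<bar> * \<bar>a i - b j\<bar>)\<close> tend to 1.\<close>

lemma trace_dist_exp_scaleR_tendsto:
  fixes H K :: "complex^'n^'n"
  assumes "hermitian H" "hermitian K"
  shows "((\<lambda>t. (trace_dist (herm_exp (t *\<^sub>R H)) (herm_exp (t *\<^sub>R K)))\<^sup>2 / t\<^sup>2)
    \<longlongrightarrow> (norm (H - K))\<^sup>2) (at 0)"
proof -
  obtain a b w where "spectral_pair H K a b w"
    by (rule obtain_spectral_pair[OF assms])
  then interpret spectral_pair H K a b w .
  let ?d = "\<lambda>t. (trace_dist (herm_exp (t *\<^sub>R H)) (herm_exp (t *\<^sub>R K)))\<^sup>2 / t\<^sup>2"
  let ?u = "\<lambda>t. \<Sum>i\<in>UNIV. \<Sum>j\<in>UNIV. w i j * ((a i - b j)\<^sup>2 * exp (\<bar>t\<bar> * \<bar>a i - b j\<bar>))"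
  have "(?u \<longlongrightarrow> ?u 0) (at 0)"
    by (intro tendsto_intros)
  then have "(?u \<longlongrightarrow> (norm (H - K))\<^sup>2) (at 0)"
    by (simp add: norm_diff_id)
  moreover have "(norm (H - K))\<^sup>2 \<le> ?d t" "?d t \<le> ?u t" if "t \<noteq> 0" for t
  proof -
    have "norm (t *\<^sub>R H - t *\<^sub>R K) \<le> trace_dist (herm_exp (t *\<^sub>R H)) (herm_exp (t *\<^sub>R K))"
      by (intro norm_diff_le_trace_dist_exp hermitian_scaleR assms)
    then have "(norm (t *\<^sub>R H - t *\<^sub>R K))\<^sup>2 \<le> (trace_dist (herm_exp (t *\<^sub>R H)) (herm_exp (t *\<^sub>R K)))\<^sup>2"
      by (rule power_mono) simp
    moreover have "norm (t *\<^sub>R H - t *\<^sub>R K) = \<bar>t\<bar> * norm (H - K)"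
      by (metis norm_scaleR scaleR_diff_right)
    ultimately show "(norm (H - K))\<^sup>2 \<le> ?d t"
      using that by (simp add: field_simps power_mult_distrib)
    have "(trace_dist (herm_exp (t *\<^sub>R H)) (herm_exp (t *\<^sub>R K)))\<^sup>2 \<le> t\<^sup>2 * ?u t"
      using trace_dist_exp_le_trace_gap[OF hermitian_scaleR hermitian_scaleR, OF assms, of t t]
        trace_gap_scaleR_le[of t] by linarith
    then show "?d t \<le> ?u t"
      using that by (simp add: divide_le_eq mult.commute)
  qed
  ultimately show ?thesis
    by (intro tendsto_sandwich[OF _ _ tendsto_const, of "(norm (H - K))\<^sup>2" ?d "at 0" ?u])
       (auto simp: eventually_at_filter)
qed

section \<open>Continuity of the trace metric in each argument\<close>

lemma continuous_on_matrix_mult [continuous_intros]: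
  fixes f g :: "'a::topological_space \<Rightarrow> complex^'n^'n"
  assumes "continuous_on S f" "continuous_on S g"
  shows "continuous_on S (\<lambda>x. f x ** g x)"
  unfolding matrix_matrix_mult_def by (intro continuous_intros assms)

text \<open>The inverse root of the base point is itself an exponential, so the distance is a
  composition of maps already known to be continuous.\<close>

lemma trace_dist_exp_eq:
  assumes "hermitian H" "X \<in> posdef"
  shows "herm_exp ((- 1 / 2) *\<^sub>R H) ** X ** herm_exp ((- 1 / 2) *\<^sub>R H) \<in> posdef"
    "trace_dist (herm_exp H) X
      = norm (herm_log (herm_exp ((- 1 / 2) *\<^sub>R H) ** X ** herm_exp ((- 1 / 2) *\<^sub>R H)))"
proof -
  let ?R = "herm_exp ((- 1 / 2) *\<^sub>R H)"
  have 1: "?R = herm_powr (herm_exp H) (- 1 / 2)"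
    by (simp add: herm_powr_exp assms)
  have 2: "cadjoint ?R = ?R"
    using hermitian_herm_exp[OF hermitian_scaleR[OF assms(1)], of "- 1 / 2"]
    by (simp only: hermitian_def)
  have 3: "?R ** herm_exp ((1 / 2) *\<^sub>R H) = mat 1"
    unfolding herm_exp_mult[OF assms(1)] by (simp add: herm_exp_0)
  show "?R ** X ** ?R \<in> posdef" "trace_dist (herm_exp H) X = norm (herm_log (?R ** X ** ?R))"
    using trace_dist_square_root[OF assms(2) 1 2 3] by auto
qed

lemma continuous_on_trace_dist_exp:
  fixes X :: "complex^'n^'n"
  assumes "X \<in> posdef"
  shows "continuous_on {H. hermitian H} (\<lambda>H. trace_dist (herm_exp H) X)"
proof -
  have 1: "continuous_on {H :: complex^'n^'n. hermitian H} (\<lambda>H. herm_exp ((- 1 / 2) *\<^sub>R H))"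
    by (rule continuous_on_compose2[OF continuous_on_herm_exp])
       (auto intro!: continuous_intros hermitian_scaleR simp del: scaleR_minus_left)
  have "continuous_on {H. hermitian H}
      (\<lambda>H. norm (herm_log (herm_exp ((- 1 / 2) *\<^sub>R H) ** X ** herm_exp ((- 1 / 2) *\<^sub>R H))))"
    by (intro continuous_on_norm continuous_on_compose2[OF continuous_on_herm_log]
        continuous_on_matrix_mult 1 continuous_on_const)
       (use trace_dist_exp_eq(1)[OF _ assms] in blast)
  then show ?thesis
    by (rule continuous_on_eq) (use trace_dist_exp_eq(2)[OF _ assms] in simp)
qed

lemma continuous_on_trace_dist:
  fixes Z :: "complex^'n^'n"
  assumes "Z \<in> posdef"
  shows "continuous_on posdef (trace_dist Z)"
proof -
  define H where "H = herm_log Z"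
  have H: "hermitian H" "Z = herm_exp H"
    using assms by (auto simp: H_def hermitian_herm_log herm_exp_log)
  have "continuous_on posdef
      (\<lambda>X. norm (herm_log (herm_exp ((- 1 / 2) *\<^sub>R H) ** X ** herm_exp ((- 1 / 2) *\<^sub>R H))))"
    by (intro continuous_on_norm continuous_on_compose2[OF continuous_on_herm_log]
        continuous_on_matrix_mult continuous_on_const continuous_on_id)
       (use trace_dist_exp_eq(1)[OF H(1)] in blast)
  then show ?thesis
    unfolding H(2) by (rule continuous_on_eq) (use trace_dist_exp_eq(2)[OF H(1)] in simp)
qed

section \<open>The Cartan barycenter\<close>

lemma space_borel_posdef: "space borel_posdef = posdef"
  by (simp add: borel_posdef_def space_restrict_space)

lemma measurable_borel_posdef:
  fixes f :: "complex^'n^'n \<Rightarrow> 'a::topological_space"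
  assumes "continuous_on posdef f"
  shows "f \<in> borel_measurable borel_posdef"
  unfolding borel_posdef_def by (rule borel_measurable_continuous_on_restrict[OF assms])

lemma square_le_exp: "0 \<le> x \<Longrightarrow> x\<^sup>2 \<le> 2 * exp x" for x :: real
  using exp_lower_Taylor_quadratic[of x] by simp

text \<open>The exponent 2 comes from the distance bound x^2 exp x \<le> 2 exp (2 x), where x is the
  sum of the norms of the two logarithms. The assumption makes squared distances integrable, and
  small powers of the given measure satisfy it.\<close>

locale exp_moment = prob_space M for M :: "(complex^'n^'n) measure" +
  assumes sets_M: "sets M = sets borel_posdef"
    and integrable_exp: "integrable M (\<lambda>X. exp (2 * norm (herm_log X)))"
begin

lemma space_M: "space M = posdef"
  using sets_eq_imp_space_eq[OF sets_M] by (simp add: space_borel_posdef)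

lemma measurable_M: "continuous_on posdef f \<Longrightarrow> f \<in> borel_measurable M"
  for f :: "complex^'n^'n \<Rightarrow> 'a::topological_space"
  using measurable_borel_posdef measurable_cong_sets[OF sets_M refl] by blast

definition mean_square_dist :: "complex^'n^'n \<Rightarrow> real" where
  "mean_square_dist Z = (\<integral>X. (trace_dist Z X)\<^sup>2 \<partial>M)"

text \<open>Uniform over the ball of radius \<open>R\<close>, so that a single integrable function
  dominates along a convergent sequence of base points.\<close>

lemma trace_dist_square_le:
  fixes H X :: "complex^'n^'n"
  assumes "hermitian H" "norm H \<le> R" "X \<in> posdef"
  shows "(trace_dist (herm_exp H) X)\<^sup>2
    \<le> 2 * CARD('n) * exp (2 * R) * exp (2 * norm (herm_log X))"
proof -
  let ?x = "norm H + norm (herm_log X)"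
  have "(trace_dist (herm_exp H) X)\<^sup>2 \<le> CARD('n) * (?x\<^sup>2 * exp ?x)"
    using trace_dist_exp_scaleR_le[OF assms(1) hermitian_herm_log[OF assms(3)], of 1]
    by (simp add: herm_exp_log assms)
  also have "\<dots> \<le> CARD('n) * ((2 * exp ?x) * exp ?x)"
    using square_le_exp[of ?x] by (intro mult_left_mono mult_right_mono) auto
  also have "\<dots> = 2 * CARD('n) * exp (2 * norm H) * exp (2 * norm (herm_log X))"
    unfolding exp_double exp_add power2_eq_square by (simp only: of_nat_mult of_nat_numeral mult_ac)
  also have "\<dots> \<le> 2 * CARD('n) * exp (2 * R) * exp (2 * norm (herm_log X))"
    using assms by (intro mult_left_mono mult_right_mono) auto
  finally show ?thesis .
qed

lemma integrable_trace_dist_square: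
  assumes "Z \<in> posdef"
  shows "integrable M (\<lambda>X. (trace_dist Z X)\<^sup>2)"
proof (rule Bochner_Integration.integrable_bound)
  let ?C = "2 * CARD('n) * exp (2 * norm (herm_log Z))"
  show "integrable M (\<lambda>X. ?C * exp (2 * norm (herm_log X)))"
    using integrable_exp by simp
  show "(\<lambda>X. (trace_dist Z X)\<^sup>2) \<in> borel_measurable M"
    by (intro measurable_M continuous_intros continuous_on_trace_dist assms)
  show "AE X in M. norm ((trace_dist Z X)\<^sup>2) \<le> norm (?C * exp (2 * norm (herm_log X)))"
    using trace_dist_square_le[OF hermitian_herm_log[OF assms] order_refl]
    by (intro AE_I2) (simp add: space_M herm_exp_log assms)
qed

text \<open>Both squared distances are integrable separately, so minimizing the objective amounts to
  minimizing \<open>mean_square_dist\<close>, whatever the base point.\<close>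

lemma cartan_objective_eq:
  assumes "Y \<in> posdef" "Z \<in> posdef"
  shows "cartan_objective M Y Z = mean_square_dist Z - mean_square_dist Y"
  unfolding cartan_objective_def mean_square_dist_def
  by (intro Bochner_Integration.integral_diff integrable_trace_dist_square assms)

section \<open>Existence and uniqueness of the minimizer\<close>

lemma continuous_on_objective: "continuous_on {H. hermitian H} (\<lambda>H. mean_square_dist (herm_exp H))"
  unfolding continuous_on_sequentially
proof (intro allI ballI impI, elim conjE)
  fix h :: "nat \<Rightarrow> complex^'n^'n" and H
  assume H: "H \<in> {H. hermitian H}" and h: "\<forall>n. h n \<in> {H. hermitian H}" and lim: "h \<longlonglongrightarrow> H"
  obtain R where R: "\<And>n. norm (h n) \<le> R"
    using convergent_imp_bounded[OF lim] by (auto simp: bounded_iff)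
  let ?C = "2 * CARD('n) * exp (2 * R)"
  show "((\<lambda>H. mean_square_dist (herm_exp H)) \<circ> h) \<longlonglongrightarrow> mean_square_dist (herm_exp H)"
    unfolding comp_def mean_square_dist_def
  proof (rule integral_dominated_convergence)
    show "(\<lambda>X. (trace_dist (herm_exp H) X)\<^sup>2) \<in> borel_measurable M"
      "(\<lambda>X. (trace_dist (herm_exp (h n)) X)\<^sup>2) \<in> borel_measurable M" for n
      using H h by (auto intro!: measurable_M continuous_intros continuous_on_trace_dist posdef_herm_exp)
    show "integrable M (\<lambda>X. ?C * exp (2 * norm (herm_log X)))"
      using integrable_exp by simp
    show "AE X in M. (\<lambda>n. (trace_dist (herm_exp (h n)) X)\<^sup>2) \<longlonglongrightarrow> (trace_dist (herm_exp H) X)\<^sup>2"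
    proof (intro AE_I2 tendsto_power)
      fix X assume "X \<in> space M"
      then have "X \<in> posdef" by (simp add: space_M)
      then show "(\<lambda>n. trace_dist (herm_exp (h n)) X) \<longlonglongrightarrow> trace_dist (herm_exp H) X"
        using continuous_on_tendsto_compose[OF continuous_on_trace_dist_exp lim H] h by simp
    qed
    show "AE X in M. norm ((trace_dist (herm_exp (h n)) X)\<^sup>2) \<le> ?C * exp (2 * norm (herm_log X))" for n
      using trace_dist_square_le[OF _ R] h by (intro AE_I2) (simp add: space_M)
  qed
qed

text \<open>Coercivity in logarithmic coordinates: the triangle inequality through
  \<open>herm_log X\<close> is squared and integrated, with the metric increasing property at
  \<open>H\<close> and equality at the identity.\<close>

lemma norm_le_objective:
  assumes "hermitian H"
  shows "(norm H)\<^sup>2 / 2 \<le> mean_square_dist (herm_exp H) + mean_square_dist (mat 1)"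
proof -
  have int: "integrable M (\<lambda>X. (trace_dist (herm_exp H) X)\<^sup>2)" "integrable M (\<lambda>X. (trace_dist (mat 1) X)\<^sup>2)"
    by (auto intro!: integrable_trace_dist_square posdef_herm_exp posdef_mat_1 assms)
  have "(norm H)\<^sup>2 / 2 = (\<integral>X. (norm H)\<^sup>2 / 2 \<partial>M)"
    by (simp add: prob_space)
  also have "\<dots> \<le> (\<integral>X. (trace_dist (herm_exp H) X)\<^sup>2 + (trace_dist (mat 1) X)\<^sup>2 \<partial>M)"
  proof (rule integral_mono)
    fix X assume "X \<in> space M"
    then have X: "X \<in> posdef" by (simp add: space_M)
    let ?K = "herm_log X"
    have "norm (H - ?K) \<le> trace_dist (herm_exp H) X"
      using norm_diff_le_trace_dist_exp[OF assms hermitian_herm_log[OF X]]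
      by (simp add: herm_exp_log X)
    then have 1: "(norm (H - ?K))\<^sup>2 \<le> (trace_dist (herm_exp H) X)\<^sup>2"
      by (rule power_mono) simp
    have "(norm H)\<^sup>2 \<le> (norm (H - ?K) + norm ?K)\<^sup>2"
      using norm_triangle_ineq[of "H - ?K" ?K] by (intro power_mono) auto
    also have "\<dots> \<le> 2 * ((norm (H - ?K))\<^sup>2 + (norm ?K)\<^sup>2)"
      using sum_squares_bound[of "norm (H - ?K)" "norm ?K"] by (simp add: power2_sum)
    finally show "(norm H)\<^sup>2 / 2 \<le> (trace_dist (herm_exp H) X)\<^sup>2 + (trace_dist (mat 1) X)\<^sup>2"
      using 1 by (simp add: trace_dist_mat_1 X)
  qed (use int in auto)
  also have "\<dots> = mean_square_dist (herm_exp H) + mean_square_dist (mat 1)"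
    unfolding mean_square_dist_def by (rule Bochner_Integration.integral_add[OF int])
  finally show ?thesis .
qed

lemma objective_has_minimizer:
  obtains Z where "Z \<in> posdef" "\<And>W. W \<in> posdef \<Longrightarrow> mean_square_dist Z \<le> mean_square_dist W"
proof -
  \<comment> \<open>Outside the ball of radius \<open>R\<close> coercivity makes the objective at
    least its value at the identity, and the identity is represented inside the ball by 0. A minimum
    over the ball is thus global.\<close>
  define R where "R = 2 * sqrt (mean_square_dist (mat 1))"
  have at_1: "mean_square_dist (mat 1) \<ge> 0" by (simp add: mean_square_dist_def)
  define S where "S = {H :: complex^'n^'n. hermitian H} \<inter> cball 0 R"
  have "closed {H :: complex^'n^'n. hermitian H}"
    unfolding hermitian_def
    by (intro closed_Collect_eq continuous_intros linear_continuous_on bounded_linear_cadjoint)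
  then have S: "compact S"
    unfolding S_def by (simp add: closed_Int_compact)
  have 0: "0 \<in> S" using at_1 by (simp add: S_def R_def hermitian_def vec_eq_iff)
  have "continuous_on S (\<lambda>H. mean_square_dist (herm_exp H))"
    by (rule continuous_on_subset[OF continuous_on_objective]) (auto simp: S_def)
  then obtain H where H: "H \<in> S" and min: "\<And>K. K \<in> S \<Longrightarrow> mean_square_dist (herm_exp H) \<le> mean_square_dist (herm_exp K)"
    using continuous_attains_inf[OF S] 0 by blast
  have "mean_square_dist (herm_exp H) \<le> mean_square_dist W" if W: "W \<in> posdef" for W
  proof (cases "herm_log W \<in> S")
    case True
    then show ?thesis using min[of "herm_log W"] by (simp add: herm_exp_log W)
  next
    case False
    then have "norm (herm_log W) > R"
      using hermitian_herm_log[OF W] by (simp add: S_def)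
    then have "(norm (herm_log W))\<^sup>2 \<ge> R\<^sup>2"
      using at_1 by (intro power_mono) (auto simp: R_def)
    then have "4 * mean_square_dist (mat 1) \<le> (norm (herm_log W))\<^sup>2"
      using at_1 by (simp add: R_def power_mult_distrib)
    then have "mean_square_dist (mat 1) \<le> mean_square_dist W"
      using norm_le_objective[OF hermitian_herm_log[OF W]] by (simp add: herm_exp_log W)
    then show ?thesis using min[OF 0] by (simp add: herm_exp_0)
  qed
  moreover have "herm_exp H \<in> posdef" using H by (simp add: S_def posdef_herm_exp)
  ultimately show ?thesis using that by blast
qed

text \<open>The midpoint of two distinct minimizers would improve the objective by the constant
  \<open>c\<close>, since the total mass is 1.\<close>

lemma objective_minimizer_unique:
  assumes A: "A \<in> posdef" and B: "B \<in> posdef"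
    and min: "\<And>W. W \<in> posdef \<Longrightarrow> mean_square_dist A \<le> mean_square_dist W" "\<And>W. W \<in> posdef \<Longrightarrow> mean_square_dist B \<le> mean_square_dist W"
  shows "A = B"
proof (rule ccontr)
  assume "A \<noteq> B"
  then obtain G c where G: "G \<in> posdef" and c: "c > 0" and
    le: "\<And>X. X \<in> posdef \<Longrightarrow> (trace_dist G X)\<^sup>2 \<le> ((trace_dist A X)\<^sup>2 + (trace_dist B X)\<^sup>2) / 2 - c"
    using trace_dist_midpoint[OF A B] by metis
  note int = integrable_trace_dist_square[OF A] integrable_trace_dist_square[OF B]
  have "mean_square_dist G \<le> (\<integral>X. ((trace_dist A X)\<^sup>2 + (trace_dist B X)\<^sup>2) / 2 - c \<partial>M)"
    unfolding mean_square_dist_def using le int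
    by (intro integral_mono integrable_trace_dist_square G) (auto simp: space_M)
  also have "\<dots> = (mean_square_dist A + mean_square_dist B) / 2 - c"
    using int by (simp add: mean_square_dist_def prob_space)
  finally show False
    using min(1)[OF G] min(2)[OF G] c by (simp add: field_simps)
qed

theorem cartan_barycenter_minimizes:
  shows "cartan_barycenter M \<in> posdef" "Z \<in> posdef \<Longrightarrow> mean_square_dist (cartan_barycenter M) \<le> mean_square_dist Z"
proof -
  \<comment> \<open>Each base point only shifts the objective by a constant, so all of them select
    the same minimizers. \<open>mat 1\<close> provides a base point for the forward
    direction.\<close>
  have iff: "(\<forall>Y\<in>posdef. is_arg_min (cartan_objective M Y) (\<lambda>W. W \<in> posdef) Z)
      \<longleftrightarrow> Z \<in> posdef \<and> (\<forall>W\<in>posdef. mean_square_dist Z \<le> mean_square_dist W)" for Z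
    using posdef_mat_1 by (auto simp: is_arg_min_def cartan_objective_eq not_less)
  obtain Z where Z: "Z \<in> posdef" "\<And>W. W \<in> posdef \<Longrightarrow> mean_square_dist Z \<le> mean_square_dist W"
    using objective_has_minimizer by blast
  have "\<exists>!Z. Z \<in> posdef \<and> (\<forall>W\<in>posdef. mean_square_dist Z \<le> mean_square_dist W)"
    using Z objective_minimizer_unique by blast
  from theI'[OF this]
  show "cartan_barycenter M \<in> posdef" "Z \<in> posdef \<Longrightarrow> mean_square_dist (cartan_barycenter M) \<le> mean_square_dist Z" for Z
    by (auto simp: cartan_barycenter_def iff)
qed

end

section \<open>Measurability of matrix powers\<close>

lemma measurable_herm_powr: "(\<lambda>X. herm_powr X t) \<in> borel_posdef \<rightarrow>\<^sub>M borel_posdef"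
proof -
  have "continuous_on posdef (\<lambda>X :: complex^'n^'n. herm_exp (t *\<^sub>R herm_log X))"
    by (rule continuous_on_compose2[OF continuous_on_herm_exp])
       (auto intro!: continuous_intros continuous_on_herm_log hermitian_scaleR hermitian_herm_log)
  then have "continuous_on posdef (\<lambda>X :: complex^'n^'n. herm_powr X t)"
    by (rule continuous_on_eq) (simp add: herm_powr_eq_exp)
  then have "(\<lambda>X :: complex^'n^'n. herm_powr X t) \<in> borel_measurable borel_posdef"
    by (rule measurable_borel_posdef)
  moreover have "herm_powr X t \<in> posdef" if "X \<in> posdef" for X :: "complex^'n^'n"
    by (simp add: herm_powr_eq_exp posdef_herm_exp hermitian_scaleR hermitian_herm_log that)
  ultimately show ?thesis
    by (subst (2) borel_posdef_def) (auto intro!: measurable_restrict_space2 simp: space_borel_posdef)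
qed

section \<open>The limit\<close>

text \<open>An eigenvalue b of \<open>herm_log X\<close> contributes exp b to the spectrum of
  \<open>X\<close> and exp (-b) to that of the inverse, so exp \<bar>b\<bar> is at most the sum of
  the operator norms. Summing the squares of all \<open>CARD('n)\<close> eigenvalues produces the
  square root.\<close>

lemma norm_herm_log_le:
  fixes X :: "complex^'n^'n"
  assumes X: "X \<in> posdef"
  shows "1 \<le> onorm ((*v) X) + onorm ((*v) (matrix_inv X))"
    "norm (herm_log X) \<le> sqrt CARD('n) * ln (onorm ((*v) X) + onorm ((*v) (matrix_inv X)))"
proof -
  let ?K = "herm_log X" and ?g = "onorm ((*v) X) + onorm ((*v) (matrix_inv X))"
  have K: "hermitian ?K" using X by (rule hermitian_herm_log)
  have bl: "bounded_linear ((*v) A)" for A :: "complex^'n^'n"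
    by simp
  have X_eq: "X = herm_fun exp ?K"
    using herm_exp_log[OF X] by (simp add: herm_exp_def)
  have inv: "matrix_inv X = herm_fun (\<lambda>x. exp (- x)) ?K"
  proof -
    have 1: "X ** herm_exp (- ?K) = mat 1"
      using herm_exp_inverse(1)[OF K] by (simp add: herm_exp_log X)
    then have "invertible X"
      unfolding invertible_def using matrix_left_right_inverse by blast
    then have "X ** matrix_inv X = mat 1"
      unfolding invertible_def matrix_inv_def by (rule someI2_ex) simp
    then show ?thesis
      using inverse_unique_right[OF _ 1] by (simp add: herm_exp_uminus K)
  qed
  obtain a b w where "spectral_pair ?K ?K a b w"
    by (rule obtain_spectral_pair[OF K K])
  then interpret spectral_pair ?K ?K a b w .
  have le: "\<bar>f (b j)\<bar> \<le> onorm ((*v) (herm_fun f ?K))" for f j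
  proof -
    obtain x where x: "norm x = 1" "herm_fun f ?K *v x = f (b j) *\<^sub>R x"
      using eigenvector by blast
    then show ?thesis using onorm[OF bl, of "herm_fun f ?K" x] by simp
  qed
  have g: "exp \<bar>b j\<bar> \<le> ?g" for j
    using le[of exp j] le[of "\<lambda>x. exp (- x)" j] onorm_pos_le[OF bl[of X]]
      onorm_pos_le[OF bl[of "matrix_inv X"]]
    unfolding inv[symmetric] X_eq[symmetric] by (cases "b j \<ge> 0") auto
  show g1: "1 \<le> ?g"
    \<comment> \<open>The index type is nonempty; \<open>undefined\<close> serves as an arbitrary
      index.\<close>
    using g[of undefined] one_le_exp_iff[of "\<bar>b undefined\<bar>"] by linarith
  have b_le: "\<bar>b j\<bar> \<le> ln ?g" for j
    using g[of j] g1 by (subst ln_ge_iff) auto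
  \<comment> \<open>The first function is zero, written as \<open>0 * x\<close> to match
    \<open>herm_fun_scaleR\<close>, so \<open>norm_diff\<close> computes the norm of
    \<open>?K\<close> itself.\<close>
  have "(norm ?K)\<^sup>2 = (\<Sum>i\<in>UNIV. \<Sum>j\<in>UNIV. w i j * (b j)\<^sup>2)"
    using norm_diff[of "\<lambda>x. 0 * x" "\<lambda>x. x"] K by (simp only: herm_fun_scaleR herm_fun_id) simp
  also have "\<dots> \<le> (\<Sum>i\<in>UNIV. \<Sum>j\<in>UNIV. w i j * (ln ?g)\<^sup>2)"
  proof (intro sum_mono mult_left_mono w_nonneg)
    show "(b j)\<^sup>2 \<le> (ln ?g)\<^sup>2" for j
      using power_mono[OF b_le[of j], of 2] by simp
  qed
  also have "\<dots> = (sqrt CARD('n) * ln ?g)\<^sup>2"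
    by (simp add: row_sum power_mult_distrib flip: sum_distrib_right)
  finally show "norm ?K \<le> sqrt CARD('n) * ln ?g"
    by (rule power2_le_imp_le) (use g1 in simp)
qed

text \<open>With y = s/2 * x, half of the exponent on the right absorbs the polynomial through y^2
  \<le> 2 exp y. The constant is 2 * (2/s)^2.\<close>

lemma square_mult_exp_le:
  fixes x s :: real
  assumes "0 \<le> x" "0 < s"
  shows "x\<^sup>2 * exp (s / 2 * x) \<le> 8 / s\<^sup>2 * exp (s * x)"
proof -
  have "(s / 2 * x)\<^sup>2 * exp (s / 2 * x) \<le> (2 * exp (s / 2 * x)) * exp (s / 2 * x)"
    using square_le_exp[of "s / 2 * x"] assms by (intro mult_right_mono) auto
  also have "\<dots> = 2 * exp (s * x)"
    by (simp add: mult_exp_exp mult.assoc)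
  finally show ?thesis
    using assms by (simp add: field_simps power2_eq_square)
qed

section \<open>Convergence of the barycenters\<close>

lemma cartan_barycenter_powr_tendsto:
  fixes \<mu> :: "(complex^'n^'n) measure" and s :: real
  assumes "prob_space \<mu>" and sets: "sets \<mu> = sets borel_posdef" and s: "s > 0"
    and int: "integrable \<mu> (\<lambda>X. exp (s * norm (herm_log X)))"
  shows "((\<lambda>t::real. herm_powr (cartan_barycenter (measure_powr \<mu> t)) (1 / t))
           \<longlongrightarrow> herm_exp (\<integral>X. herm_log X \<partial>\<mu>)) (at 0)"
proof -
  interpret prob_space \<mu> by fact
  have space: "space \<mu> = posdef"
    using sets_eq_imp_space_eq[OF sets] by (simp add: space_borel_posdef)
  have meas: "f \<in> borel_measurable \<mu>" if "f \<in> borel_measurable borel_posdef"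
    for f :: "complex^'n^'n \<Rightarrow> 'b::topological_space"
    using that measurable_cong_sets[OF sets refl] by blast
  have powr_meas: "(\<lambda>X. herm_powr X t) \<in> \<mu> \<rightarrow>\<^sub>M borel_posdef" for t
    using measurable_herm_powr[of t] measurable_cong_sets[OF sets refl] by blast
  have log_meas: "herm_log \<in> borel_measurable \<mu>"
    by (intro meas measurable_borel_posdef continuous_on_herm_log)
  have dist_meas: "(\<lambda>X. (trace_dist Z (herm_powr X t))\<^sup>2) \<in> borel_measurable \<mu>" if "Z \<in> posdef" for Z t
    using measurable_compose[OF powr_meas measurable_borel_posdef[OF continuous_on_trace_dist[OF that]]]
    by (intro borel_measurable_power)
  have int_log2: "integrable \<mu> (\<lambda>X. (norm (herm_log X))\<^sup>2)"
  proof (rule Bochner_Integration.integrable_bound)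
    show "integrable \<mu> (\<lambda>X. 8 / s\<^sup>2 * exp (s * norm (herm_log X)))" using int by simp
    show "(\<lambda>X. (norm (herm_log X))\<^sup>2) \<in> borel_measurable \<mu>" using log_meas by simp
    have "x\<^sup>2 \<le> 8 / s\<^sup>2 * exp (s * x)" if "x \<ge> 0" for x
    proof -
      have "x\<^sup>2 * 1 \<le> x\<^sup>2 * exp (s / 2 * x)"
        using that s by (intro mult_left_mono) auto
      then show ?thesis using square_mult_exp_le[OF that s] by linarith
    qed
    then show "AE X in \<mu>. norm ((norm (herm_log X))\<^sup>2) \<le> norm (8 / s\<^sup>2 * exp (s * norm (herm_log X)))"
      by (intro AE_I2) simp
  qed
  have int_log: "integrable \<mu> herm_log"
  proof (rule Bochner_Integration.integrable_bound)
    show "integrable \<mu> (\<lambda>X. 1 + (norm (herm_log X))\<^sup>2)" using int_log2 by simp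
    have "x \<le> 1 + x\<^sup>2" for x :: real
      using sum_squares_bound[of x 1] zero_le_power2[of x] unfolding power_one mult_1_right
      by linarith
    then show "AE X in \<mu>. norm (herm_log X) \<le> norm (1 + (norm (herm_log X))\<^sup>2)"
      by (intro AE_I2) (simp add: abs_of_nonneg)
  qed (rule log_meas)
  define L where "L = (\<integral>X. herm_log X \<partial>\<mu>)"
  have hL: "hermitian L"
  proof -
    have "cadjoint L = (\<integral>X. cadjoint (herm_log X) \<partial>\<mu>)"
      unfolding L_def by (rule integral_bounded_linear[OF bounded_linear_cadjoint int_log, symmetric])
    also have "\<dots> = L"
      unfolding L_def using hermitian_herm_log
      by (intro Bochner_Integration.integral_cong refl) (auto simp: hermitian_def space)
    finally show ?thesis by (simp add: hermitian_def)
  qed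
  define V where "V = (\<integral>X. (norm (L - herm_log X))\<^sup>2 \<partial>\<mu>)"
  have int_diff2: "integrable \<mu> (\<lambda>X. (norm (W - herm_log X))\<^sup>2)" for W
  proof -
    have "(norm (W - herm_log X))\<^sup>2 = (norm W)\<^sup>2 - 2 * (W \<bullet> herm_log X) + (norm (herm_log X))\<^sup>2" for X
      by (simp add: power2_norm_eq_inner inner_diff_left inner_diff_right inner_commute)
    then show ?thesis using int_log int_log2 by simp
  qed
  \<comment> \<open>The Euclidean variance decomposition: the cross term integrates to 0 because
    \<open>L\<close> is the mean of \<open>herm_log\<close>.\<close>
  have variance: "(\<integral>X. (norm (W - herm_log X))\<^sup>2 \<partial>\<mu>) = (norm (W - L))\<^sup>2 + V" for W
  proof -
    have eq: "(norm (W - herm_log X))\<^sup>2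
        = (norm (W - L))\<^sup>2 + 2 * ((W - L) \<bullet> (L - herm_log X)) + (norm (L - herm_log X))\<^sup>2" for X
      by (simp add: power2_norm_eq_inner inner_diff_left inner_diff_right inner_commute algebra_simps)
    have "(\<integral>X. (W - L) \<bullet> (L - herm_log X) \<partial>\<mu>) = (W - L) \<bullet> (\<integral>X. L - herm_log X \<partial>\<mu>)"
      using int_log by (intro integral_inner_right) auto
    also have "(\<integral>X. L - herm_log X \<partial>\<mu>) = 0"
      using int_log by (simp add: prob_space flip: L_def)
    finally have 0: "(\<integral>X. (W - L) \<bullet> (L - herm_log X) \<partial>\<mu>) = 0" by simp
    show ?thesis
      unfolding eq V_def using int_log int_diff2[of L] by (simp add: 0 prob_space)
  qed
  \<comment> \<open>The mean squared distance for \<open>measure_powr \<mu> t\<close>, pulled back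
    to \<open>\<mu>\<close> so that dominated convergence runs over one fixed measure.\<close>
  define F where "F t Z = (\<integral>X. (trace_dist Z (herm_powr X t))\<^sup>2 \<partial>\<mu>)" for t Z
  define Z where "Z t = cartan_barycenter (measure_powr \<mu> t)" for t
  define W where "W t = (1 / t) *\<^sub>R herm_log (Z t)" for t
  \<comment> \<open>The restriction on \<open>t\<close> gives
    \<open>2 * \<bar>t\<bar> \<le> s\<close>, which is exactly what places
    \<open>measure_powr \<mu> t\<close> in the locale \<open>exp_moment\<close>.\<close>
  have main: "hermitian (W t) \<and> herm_powr (Z t) (1 / t) = herm_exp (W t)
      \<and> (norm (W t - L))\<^sup>2 \<le> F t (herm_exp (t *\<^sub>R L)) / t\<^sup>2 - V"
    if t: "t \<noteq> 0" "\<bar>t\<bar> \<le> s / 2" for t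
  proof -
    let ?\<nu> = "measure_powr \<mu> t"
    have log_powr: "norm (herm_log (herm_powr X t)) = \<bar>t\<bar> * norm (herm_log X)" if "X \<in> posdef" for X :: "complex^'n^'n"
      by (simp add: herm_powr_eq_exp herm_log_exp hermitian_scaleR hermitian_herm_log that)
    have exp_meas: "(\<lambda>X :: complex^'n^'n. exp (2 * norm (herm_log X))) \<in> borel_measurable borel_posdef"
      by (intro measurable_borel_posdef continuous_intros continuous_on_herm_log)
    have "integrable \<mu> (\<lambda>X. exp (2 * norm (herm_log (herm_powr X t))))"
    proof (rule Bochner_Integration.integrable_bound[OF int])
      show "(\<lambda>X. exp (2 * norm (herm_log (herm_powr X t)))) \<in> borel_measurable \<mu>"
        by (rule measurable_compose[OF powr_meas exp_meas])
      have "2 * (\<bar>t\<bar> * norm (herm_log X)) \<le> s * norm (herm_log X)" for X :: "complex^'n^'n"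
        using mult_right_mono[of "2 * \<bar>t\<bar>" s "norm (herm_log X)"] t by simp
      then show "AE X in \<mu>. norm (exp (2 * norm (herm_log (herm_powr X t))))
          \<le> norm (exp (s * norm (herm_log X)))"
        by (intro AE_I2) (simp add: log_powr space)
    qed
    then have "integrable ?\<nu> (\<lambda>X. exp (2 * norm (herm_log X)))"
      unfolding measure_powr_def by (subst integrable_distr_eq[OF powr_meas exp_meas])
    moreover have "prob_space ?\<nu>"
      unfolding measure_powr_def by (rule prob_space_distr[OF powr_meas])
    moreover have "sets ?\<nu> = sets borel_posdef" by (simp add: measure_powr_def)
    ultimately interpret \<nu>: exp_moment ?\<nu>
      by (intro exp_moment.intro exp_moment_axioms.intro)
    have mean_eq: "\<nu>.mean_square_dist Y = F t Y" if "Y \<in> posdef" for Y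
      unfolding \<nu>.mean_square_dist_def F_def unfolding measure_powr_def
      by (intro integral_distr[OF powr_meas] borel_measurable_power measurable_borel_posdef
          continuous_on_trace_dist that)
    have int_F: "integrable \<mu> (\<lambda>X. (trace_dist Y (herm_powr X t))\<^sup>2)" if "Y \<in> posdef" for Y
      using \<nu>.integrable_trace_dist_square[OF that] unfolding measure_powr_def
      by (subst (asm) integrable_distr_eq[OF powr_meas])
         (intro borel_measurable_power measurable_borel_posdef continuous_on_trace_dist that)
    have Zp: "Z t \<in> posdef" unfolding Z_def by (rule \<nu>.cartan_barycenter_minimizes)
    have Wh: "hermitian (W t)"
      unfolding W_def by (intro hermitian_scaleR hermitian_herm_log Zp)
    have Z_eq: "Z t = herm_exp (t *\<^sub>R W t)"
      using t by (simp add: W_def herm_exp_log Zp)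
    have pL: "herm_exp (t *\<^sub>R L) \<in> posdef" by (intro posdef_herm_exp hermitian_scaleR hL)
    \<comment> \<open>The variance identity scaled by \<open>t\<^sup>2\<close>, since
      \<open>t *\<^sub>R W t\<close> and \<open>t *\<^sub>R herm_log X\<close> are the logarithms of
      \<open>Z t\<close> and \<open>herm_powr X t\<close>. The competitor for minimality is then
      \<open>herm_exp (t *\<^sub>R L)\<close>.\<close>
    have "t\<^sup>2 * ((norm (W t - L))\<^sup>2 + V) = (\<integral>X. t\<^sup>2 * (norm (W t - herm_log X))\<^sup>2 \<partial>\<mu>)"
      using int_diff2 by (simp add: variance)
    also have "\<dots> \<le> F t (Z t)"
      unfolding F_def
    proof (rule integral_mono)
      fix X assume "X \<in> space \<mu>"
      then have X: "X \<in> posdef" by (simp add: space)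
      have "norm (t *\<^sub>R W t - t *\<^sub>R herm_log X) \<le> trace_dist (Z t) (herm_powr X t)"
        unfolding Z_eq herm_powr_eq_exp[OF X]
        by (intro norm_diff_le_trace_dist_exp hermitian_scaleR Wh hermitian_herm_log X)
      then have "(norm (t *\<^sub>R (W t - herm_log X)))\<^sup>2 \<le> (trace_dist (Z t) (herm_powr X t))\<^sup>2"
        unfolding scaleR_diff_right by (rule power_mono) simp
      then show "t\<^sup>2 * (norm (W t - herm_log X))\<^sup>2 \<le> (trace_dist (Z t) (herm_powr X t))\<^sup>2"
        by (simp add: power_mult_distrib)
    qed (use int_diff2 int_F[OF Zp] in auto)
    also have "\<dots> \<le> F t (herm_exp (t *\<^sub>R L))"
      using \<nu>.cartan_barycenter_minimizes(2)[OF pL] mean_eq[OF Zp] mean_eq[OF pL] by (simp add: Z_def)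
    finally have "(norm (W t - L))\<^sup>2 \<le> F t (herm_exp (t *\<^sub>R L)) / t\<^sup>2 - V"
      using t by (simp add: field_simps)
    moreover have "herm_powr (Z t) (1 / t) = herm_exp (W t)"
      by (simp add: herm_powr_eq_exp Zp W_def)
    ultimately show ?thesis using Wh by blast
  qed
  have ev: "\<forall>\<^sub>F t in at 0. t \<noteq> 0 \<and> \<bar>t\<bar> \<le> s / 2"
    using s unfolding eventually_at by (intro exI[of _ "s / 2"]) (auto simp: dist_real_def)
  have F_lim: "((\<lambda>t. F t (herm_exp (t *\<^sub>R L)) / t\<^sup>2) \<longlongrightarrow> V) (at 0)"
    unfolding tendsto_at_iff_sequentially comp_def
  proof (intro allI impI)
    fix t :: "nat \<Rightarrow> real"
    assume nz: "\<forall>n. t n \<in> UNIV - {0}" and t0: "t \<longlonglongrightarrow> 0"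
    let ?d = "\<lambda>n X. (trace_dist (herm_exp (t n *\<^sub>R L)) (herm_powr X (t n)))\<^sup>2 / (t n)\<^sup>2"
    \<comment> \<open>Domination needs the bound on every term, so the sequence is shifted by
      \<open>N\<close> and the shift is undone at the end.\<close>
    have "\<forall>\<^sub>F n in sequentially. \<bar>t n\<bar> < s / 2"
      using order_tendstoD(2)[OF tendsto_rabs[OF t0], of "s / 2"] s by simp
    then obtain N where N: "\<And>n. n \<ge> N \<Longrightarrow> \<bar>t n\<bar> < s / 2"
      by (auto simp: eventually_sequentially)
    \<comment> \<open>Half of the exponent \<open>s\<close> pays for the growth in \<open>t\<close>,
      the other half for the squared factor. What belongs to \<open>norm L\<close> is then split off
      into the constant.\<close>
    let ?C = "CARD('n) * (8 / s\<^sup>2) * exp (s * norm L)"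
    have "(\<lambda>n. \<integral>X. ?d (n + N) X \<partial>\<mu>) \<longlonglongrightarrow> V"
      unfolding V_def
    proof (rule integral_dominated_convergence)
      show "(\<lambda>X. (norm (L - herm_log X))\<^sup>2) \<in> borel_measurable \<mu>"
        using log_meas by simp
      show "?d (n + N) \<in> borel_measurable \<mu>" for n
        by (intro borel_measurable_divide dist_meas borel_measurable_const posdef_herm_exp
            hermitian_scaleR hL)
      show "integrable \<mu> (\<lambda>X. ?C * exp (s * norm (herm_log X)))"
        using int by simp
      show "AE X in \<mu>. (\<lambda>n. ?d (n + N) X) \<longlonglongrightarrow> (norm (L - herm_log X))\<^sup>2"
      proof (rule AE_I2)
        fix X assume "X \<in> space \<mu>"
        then have X: "X \<in> posdef" by (simp add: space)
        have "(\<lambda>n. ?d n X) \<longlonglongrightarrow> (norm (L - herm_log X))\<^sup>2"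
          using trace_dist_exp_scaleR_tendsto[OF hL hermitian_herm_log[OF X]] nz t0
          unfolding tendsto_at_iff_sequentially comp_def herm_powr_eq_exp[OF X] by blast
        then show "(\<lambda>n. ?d (n + N) X) \<longlonglongrightarrow> (norm (L - herm_log X))\<^sup>2"
          by (rule LIMSEQ_ignore_initial_segment)
      qed
      show "AE X in \<mu>. norm (?d (n + N) X) \<le> ?C * exp (s * norm (herm_log X))" for n
      proof (rule AE_I2)
        fix X assume "X \<in> space \<mu>"
        then have X: "X \<in> posdef" by (simp add: space)
        let ?t = "t (n + N)" and ?x = "norm L + norm (herm_log X)"
        have t: "?t \<noteq> 0" "\<bar>?t\<bar> \<le> s / 2" using nz N[of "n + N"] by auto
        have "(trace_dist (herm_exp (?t *\<^sub>R L)) (herm_powr X ?t))\<^sup>2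
            \<le> ?t\<^sup>2 * (CARD('n) * (?x\<^sup>2 * exp (\<bar>?t\<bar> * ?x)))"
          unfolding herm_powr_eq_exp[OF X]
          by (rule trace_dist_exp_scaleR_le[OF hL hermitian_herm_log[OF X]])
        then have "?d (n + N) X \<le> CARD('n) * (?x\<^sup>2 * exp (\<bar>?t\<bar> * ?x))"
          using t by (simp add: divide_le_eq mult.commute)
        also have "\<dots> \<le> CARD('n) * (?x\<^sup>2 * exp (s / 2 * ?x))"
          using mult_right_mono[OF t(2), of ?x] by (intro mult_left_mono) auto
        also have "\<dots> \<le> CARD('n) * (8 / s\<^sup>2 * exp (s * ?x))"
          using square_mult_exp_le[of ?x s] s by (intro mult_left_mono) auto
        also have "\<dots> = ?C * exp (s * norm (herm_log X))"
          by (simp add: distrib_left exp_add)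
        finally show "norm (?d (n + N) X) \<le> ?C * exp (s * norm (herm_log X))" by simp
      qed
    qed
    then have "(\<lambda>n. \<integral>X. ?d n X \<partial>\<mu>) \<longlonglongrightarrow> V"
      by (rule LIMSEQ_offset)
    then show "(\<lambda>n. F (t n) (herm_exp (t n *\<^sub>R L)) / (t n)\<^sup>2) \<longlonglongrightarrow> V"
      by (simp add: F_def)
  qed
  have "((\<lambda>t. (norm (W t - L))\<^sup>2) \<longlongrightarrow> 0) (at 0)"
  proof (rule tendsto_sandwich)
    show "\<forall>\<^sub>F t in at 0. 0 \<le> (norm (W t - L))\<^sup>2" by simp
    show "\<forall>\<^sub>F t in at 0. (norm (W t - L))\<^sup>2 \<le> F t (herm_exp (t *\<^sub>R L)) / t\<^sup>2 - V"
      using ev by eventually_elim (use main in blast)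
    show "((\<lambda>t. F t (herm_exp (t *\<^sub>R L)) / t\<^sup>2 - V) \<longlongrightarrow> 0) (at 0)"
      using tendsto_diff[OF F_lim tendsto_const[of V]] by simp
  qed simp
  from tendsto_real_sqrt[OF this] have "(W \<longlongrightarrow> L) (at 0)"
    by (simp add: tendsto_norm_zero_iff LIM_zero_iff)
  then have "((\<lambda>t. herm_exp (W t)) \<longlongrightarrow> herm_exp L) (at 0)"
  proof (rule continuous_on_tendsto_compose[OF continuous_on_herm_exp])
    show "\<forall>\<^sub>F t in at 0. W t \<in> {H. hermitian H}"
      using ev by eventually_elim (use main in blast)
  qed (use hL in simp)
  then show ?thesis
    unfolding L_def
  proof (rule Lim_transform_eventually)
    show "\<forall>\<^sub>F t in at 0. herm_exp (W t) = herm_powr (cartan_barycenter (measure_powr \<mu> t)) (1 / t)"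
      using ev by eventually_elim (use main in \<open>simp add: Z_def\<close>)
  qed
qed

theorem theorem5p7:
  fixes \<mu> :: "(complex^'n^'n) measure" and r :: real
  assumes "prob_space \<mu>"
    and "sets \<mu> = sets borel_posdef"
    and "r > 0"
    and "integrable \<mu> (\<lambda>X. (onorm ((*v) X) + onorm ((*v) (matrix_inv X))) powr r)"
  shows "((\<lambda>t::real. herm_powr (cartan_barycenter (measure_powr \<mu> t)) (1 / t))
           \<longlongrightarrow> herm_exp (\<integral>X. herm_log X \<partial>\<mu>)) (at 0)"
proof -
  let ?g = "\<lambda>X :: complex^'n^'n. onorm ((*v) X) + onorm ((*v) (matrix_inv X))"
  \<comment> \<open>Dividing by the root of the dimension cancels the factor in
    \<open>norm_herm_log_le\<close>, so that \<open>s * norm (herm_log X)\<close> is at most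
    \<open>r * ln (?g X)\<close>.\<close>
  define s where "s = r / sqrt CARD('n)"
  have s: "s > 0" using assms by (simp add: s_def)
  have space: "space \<mu> = posdef"
    using sets_eq_imp_space_eq[OF assms(2)] by (simp add: space_borel_posdef)
  have "integrable \<mu> (\<lambda>X. exp (s * norm (herm_log X)))"
  proof (rule Bochner_Integration.integrable_bound[OF assms(4)])
    have "(\<lambda>X :: complex^'n^'n. exp (s * norm (herm_log X))) \<in> borel_measurable borel_posdef"
      by (intro measurable_borel_posdef continuous_intros continuous_on_herm_log)
    then show "(\<lambda>X. exp (s * norm (herm_log X))) \<in> borel_measurable \<mu>"
      using measurable_cong_sets[OF assms(2) refl] by blast
    have "exp (s * norm (herm_log X)) \<le> ?g X powr r" if X: "X \<in> posdef" for X :: "complex^'n^'n"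
    proof -
      have "s * norm (herm_log X) \<le> s * (sqrt CARD('n) * ln (?g X))"
        using norm_herm_log_le(2)[OF X] s by (intro mult_left_mono) auto
      also have "\<dots> = r * ln (?g X)" by (simp add: s_def)
      finally show ?thesis
        using norm_herm_log_le(1)[OF X] by (simp add: powr_def)
    qed
    then show "AE X in \<mu>. norm (exp (s * norm (herm_log X))) \<le> norm (?g X powr r)"
      by (intro AE_I2) (simp add: space)
  qed
  then show ?thesis by (rule cartan_barycenter_powr_tendsto[OF assms(1,2) s])
qed

end
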